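(* Let $G$ be a graph from one of the following families: (a) the $d$-cubes $Q_d$, for $d\ge2$; (b) the cocktail party graphs $\overline{nK_2}$, where $n$ is even ($n\ge 2$); (c) the halved $2d$-cubes $\tfrac12Q_{2d}$, for $d\ge1$. Then $G\circ K_1$ has pretty good state transfer between antipodal vertices in $G$; that is, whenever $u,v$ are antipodal vertices of $G$, there is pretty good state transfer between $(u,0)$ and $(v,0)$ in $G\circ K_1$.
   Context: $Q_d$ is the $d$-dimensional hypercube graph on $\{0,1\}^d$. $\overline{nK_2}$ is the complement of the disjoint union of $n$ copies of $K_2$. The halved cube $\tfrac12Q_{2d}$ has as vertices the binary words of length $2d$ of even weight, two being adjacent iff they differ in exactly two positions. Two vertices of $G$ are antipodal if their distance in $G$ equals the diameter of $G$. $K_1$ is the one-vertex graph. The corona $G\circ H$ of graphs $G,H$ has vertex set $V(G)\times(\{0\}\cup V(H))$ (where $0\notin V(H)$), and $(v,w)$ is adjacent to $(v',w')$ iff one of the following holds: $w=w'=0$ and $v,v'$ are adjacent in $G$; or $v=v'$ and $w,w'\in V(H)$ are adjacent in $H$; or $v=v'$ and exactly one of $w,w'$ equals $0$. A graph $X$ with adjacency matrix $A(X)$ has pretty good state transfer between vertices $a,b$ if for every $\epsilon>0$ there are a time $\tau$ and a complex number $\gamma$ with $|\gamma|=1$ such that $\|e^{-\mathrm{i}\tau A(X)}e_a-\gamma e_b\|<\epsilon$, where $e_a$ is the standard basis vector indexed by $a$. *)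

theory Defs
  imports
    "HOL-Analysis.Analysis"
    "Graph_Theory.Pair_Digraph"
    "Graph_Theory.Shortest_Path"
begin

text \<open>
  A finite simple graph is a \<open>pair_graph\<close>: a finite loopless digraph whose arc
  relation is symmetric.
\<close>

section \<open>Graph constructions\<close>

definition complete_1 :: "unit pair_pre_digraph" where
  "complete_1 = \<lparr> pverts = {()}, parcs = {} \<rparr>"

definition complete_2 :: "bool pair_pre_digraph" where
  "complete_2 = \<lparr> pverts = UNIV, parcs = {(x, y). x \<noteq> y} \<rparr>"

definition disjoint_copies :: "nat \<Rightarrow> 'a pair_pre_digraph \<Rightarrow> (nat \<times> 'a) pair_pre_digraph" where
  "disjoint_copies n G =
    \<lparr> pverts = {..<n} \<times> pverts G,
      parcs = {((i, x), (j, y)). i < n \<and> i = j \<and> (x, y) \<in> parcs G} \<rparr>"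

definition graph_complement :: "'a pair_pre_digraph \<Rightarrow> 'a pair_pre_digraph" where
  "graph_complement G =
    \<lparr> pverts = pverts G,
      parcs = {(x, y). x \<in> pverts G \<and> y \<in> pverts G \<and> x \<noteq> y \<and> (x, y) \<notin> parcs G} \<rparr>"

text \<open>The extra symbol \<open>0 \<notin> V(H)\<close> of the corona is \<open>None\<close>; \<open>w \<in> V(H)\<close> appears as \<open>Some w\<close>.\<close>

definition corona :: "'a pair_pre_digraph \<Rightarrow> 'b pair_pre_digraph \<Rightarrow> ('a \<times> 'b option) pair_pre_digraph" where
  "corona G H =
    (let V = pverts G \<times> insert None (Some ` pverts H) in
     \<lparr> pverts = V,
       parcs = {((v, w), (v', w')). (v, w) \<in> V \<and> (v', w') \<in> V \<and>
         (w = None \<and> w' = None \<and> (v, v') \<in> parcs G \<or>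
          v = v' \<and> (\<exists>x y. w = Some x \<and> w' = Some y \<and> (x, y) \<in> parcs H) \<or>
          v = v' \<and> (w = None) \<noteq> (w' = None))} \<rparr>)"

section \<open>The three families\<close>

definition hamming_dist :: "bool list \<Rightarrow> bool list \<Rightarrow> nat" where
  "hamming_dist x y = card {i. i < length x \<and> x ! i \<noteq> y ! i}"

definition weight :: "bool list \<Rightarrow> nat" where
  "weight x = card {i. i < length x \<and> x ! i}"

definition hypercube :: "nat \<Rightarrow> bool list pair_pre_digraph" where
  "hypercube d =
    (let V = {x. length x = d} in
     \<lparr> pverts = V, parcs = {(x, y). x \<in> V \<and> y \<in> V \<and> hamming_dist x y = 1} \<rparr>)"

definition cocktail_party :: "nat \<Rightarrow> (nat \<times> bool) pair_pre_digraph" where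
  "cocktail_party n = graph_complement (disjoint_copies n complete_2)"

text \<open>The parameter is the word length, so \<open>halved_cube (2 * d)\<close> is the halved \<open>2d\<close>-cube.\<close>

definition halved_cube :: "nat \<Rightarrow> bool list pair_pre_digraph" where
  "halved_cube m =
    (let V = {x. length x = m \<and> even (weight x)} in
     \<lparr> pverts = V, parcs = {(x, y). x \<in> V \<and> y \<in> V \<and> hamming_dist x y = 2} \<rparr>)"

section \<open>Distance and antipodal vertices\<close>

text \<open>
  With unit arc weights, \<open>\<mu>\<close> is the least number of arcs of a walk (\<open>\<infinity>\<close> if there is none).
\<close>

definition graph_dist :: "'a pair_pre_digraph \<Rightarrow> 'a \<Rightarrow> 'a \<Rightarrow> ereal" where
  "graph_dist G u v = wf_digraph.\<mu> (with_proj G) (\<lambda>_. 1) u v"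

definition graph_diameter :: "'a pair_pre_digraph \<Rightarrow> ereal" where
  "graph_diameter G = (SUP (u, v) \<in> pverts G \<times> pverts G. graph_dist G u v)"

definition antipodal :: "'a pair_pre_digraph \<Rightarrow> 'a \<Rightarrow> 'a \<Rightarrow> bool" where
  "antipodal G u v \<longleftrightarrow>
    u \<in> pverts G \<and> v \<in> pverts G \<and> graph_dist G u v = graph_diameter G"

section \<open>Pretty good state transfer\<close>

text \<open>
  Matrices and vectors are indexed by the elements of a finite set \<open>V\<close>; only their
  values on \<open>V\<close> matter.
\<close>

definition adjacency_matrix :: "'a pair_pre_digraph \<Rightarrow> 'a \<Rightarrow> 'a \<Rightarrow> complex" where
  "adjacency_matrix G x y = (if (x, y) \<in> parcs G then 1 else 0)"

primrec matrix_power :: "'a set \<Rightarrow> ('a \<Rightarrow> 'a \<Rightarrow> complex) \<Rightarrow> nat \<Rightarrow> 'a \<Rightarrow> 'a \<Rightarrow> complex" where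
  "matrix_power V M 0 = (\<lambda>x y. if x = y then 1 else 0)"
| "matrix_power V M (Suc k) = (\<lambda>x y. \<Sum>z\<in>V. M x z * matrix_power V M k z y)"

definition matrix_exp :: "'a set \<Rightarrow> ('a \<Rightarrow> 'a \<Rightarrow> complex) \<Rightarrow> 'a \<Rightarrow> 'a \<Rightarrow> complex" where
  "matrix_exp V M x y = (\<Sum>k. matrix_power V M k x y / fact k)"

definition matrix_vector :: "'a set \<Rightarrow> ('a \<Rightarrow> 'a \<Rightarrow> complex) \<Rightarrow> ('a \<Rightarrow> complex) \<Rightarrow> 'a \<Rightarrow> complex" where
  "matrix_vector V M f x = (\<Sum>y\<in>V. M x y * f y)"

definition basis_vector :: "'a \<Rightarrow> 'a \<Rightarrow> complex" where
  "basis_vector a x = (if x = a then 1 else 0)"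

definition vector_norm :: "'a set \<Rightarrow> ('a \<Rightarrow> complex) \<Rightarrow> real" where
  "vector_norm V f = L2_set (\<lambda>x. norm (f x)) V"

definition transition_matrix :: "'a pair_pre_digraph \<Rightarrow> real \<Rightarrow> 'a \<Rightarrow> 'a \<Rightarrow> complex" where
  "transition_matrix X t =
    matrix_exp (pverts X) (\<lambda>x y. - \<i> * of_real t * adjacency_matrix X x y)"

definition pretty_good_state_transfer :: "'a pair_pre_digraph \<Rightarrow> 'a \<Rightarrow> 'a \<Rightarrow> bool" where
  "pretty_good_state_transfer X a b \<longleftrightarrow>
    (\<forall>\<epsilon>>0. \<exists>(\<tau>::real) (\<gamma>::complex). norm \<gamma> = 1 \<and>
      vector_norm (pverts X) (\<lambda>x.
        matrix_vector (pverts X) (transition_matrix X \<tau>) (basis_vector a) x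
          - \<gamma> * basis_vector b x) < \<epsilon>)"

section \<open>Well-definedness\<close>

lemma matrix_power_bound:
  assumes "finite V"
  shows "\<exists>C\<ge>0. \<forall>k. \<forall>x\<in>V. norm (matrix_power V M k x y) \<le> C ^ k"
proof -
  define C where "C = (\<Sum>x\<in>V. \<Sum>z\<in>V. norm (M x z))"
  have C0: "C \<ge> 0"
    unfolding C_def by (intro sum_nonneg) auto
  have row: "(\<Sum>z\<in>V. norm (M x z)) \<le> C" if "x \<in> V" for x
    unfolding C_def using assms that
    by (intro member_le_sum[where f = "\<lambda>x. \<Sum>z\<in>V. norm (M x z)"]) (auto intro: sum_nonneg)
  have "\<forall>x\<in>V. norm (matrix_power V M k x y) \<le> C ^ k" for k
  proof (induction k)
    case 0
    then show ?case by simp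
  next
    case (Suc k)
    show ?case
    proof
      fix x assume x: "x \<in> V"
      have "norm (matrix_power V M (Suc k) x y) \<le> (\<Sum>z\<in>V. norm (M x z) * C ^ k)"
        using Suc by (auto intro!: sum_norm_le mult_left_mono simp: norm_mult)
      also have "\<dots> \<le> C * C ^ k"
        using row[OF x] C0 by (auto simp flip: sum_distrib_right intro!: mult_right_mono)
      finally show "norm (matrix_power V M (Suc k) x y) \<le> C ^ Suc k" by simp
    qed
  qed
  then show ?thesis using C0 by blast
qed

lemma summable_matrix_exp:
  assumes "finite V" "x \<in> V"
  shows "summable (\<lambda>k. matrix_power V M k x y / fact k)"
proof -
  obtain C where C: "\<And>k. norm (matrix_power V M k x y) \<le> C ^ k"
    using matrix_power_bound[OF assms(1), of M y] assms(2) by blast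
  have "summable (\<lambda>k. C ^ k / fact k)"
    using summable_exp[of C] by (simp add: field_simps)
  then show ?thesis
    by (rule summable_comparison_test'[where N = 0])
       (auto simp: norm_divide intro!: divide_right_mono C)
qed

lemma pair_graphI:
  assumes "finite (pverts G)" "parcs G \<subseteq> pverts G \<times> pverts G"
    and "sym (parcs G)" "\<And>x. (x, x) \<notin> parcs G"
  shows "pair_graph G"
proof -
  have "finite (parcs G)"
    using assms(1,2) finite_subset by blast
  then show ?thesis
    using assms
    by unfold_locales (auto simp: symmetric_def arcs_ends_def arc_to_ends_def)
qed

lemma finite_words: "finite {x :: bool list. length x = m \<and> P x}"
  using finite_lists_length_eq[of "UNIV :: bool set" m] by (auto intro: finite_subset[rotated])

lemma hamming_dist_commute: "length x = length y \<Longrightarrow> hamming_dist x y = hamming_dist y x"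
  unfolding hamming_dist_def by (metis (no_types, lifting))

lemma pair_graph_hypercube: "pair_graph (hypercube d)"
  by (rule pair_graphI)
     (use finite_words[of d "\<lambda>_. True"] in
       \<open>auto simp: hypercube_def sym_def hamming_dist_commute, auto simp: hamming_dist_def\<close>)

lemma pair_graph_halved_cube: "pair_graph (halved_cube m)"
  by (rule pair_graphI)
     (use finite_words[of m "\<lambda>x. even (weight x)"] in
       \<open>auto simp: halved_cube_def sym_def hamming_dist_commute, auto simp: hamming_dist_def\<close>)

lemma pair_graph_cocktail_party: "pair_graph (cocktail_party n)"
  by (rule pair_graphI)
     (auto simp: cocktail_party_def graph_complement_def disjoint_copies_def complete_2_def sym_def)

lemma pair_graph_complete_1: "pair_graph complete_1"
  by (rule pair_graphI) (auto simp: complete_1_def sym_def)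

lemma pair_graph_corona:
  assumes "pair_graph G" "pair_graph H"
  shows "pair_graph (corona G H)"
proof -
  interpret G: pair_graph G by fact
  interpret H: pair_graph H by fact
  have "sym (parcs G)" "sym (parcs H)"
    using G.pair_sym_arcs H.pair_sym_arcs
    by (auto simp: symmetric_def arcs_ends_def arc_to_ends_def)
  moreover have "(x, x) \<notin> parcs G" "(y, y) \<notin> parcs H" for x y
    using G.pair_no_loops H.pair_no_loops by fastforce+
  ultimately show ?thesis
    using G.pair_finite_verts H.pair_finite_verts
    by (intro pair_graphI) (auto simp: corona_def Let_def sym_def)
qed

end

theory Submission
  imports Defs "HOL-Computational_Algebra.Squarefree"
begin

text \<open>
  All three families consist of graphs \<open>G\<close> with integer eigenvalues of a common parity and with
  perfect state transfer between antipodal vertices at time \<open>\<pi> / 2\<close>. An eigenvector \<open>f\<close> of \<open>G\<close> with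
  eigenvalue \<open>\<nu>\<close> lifts to two eigenvectors \<open>(\<mu> * f, f)\<close> of the corona with a single vertex, with
  eigenvalues \<open>\<mu> = (\<nu> \<plusminus> sqrt (\<nu>\<^sup>2 + 4)) / 2\<close>. Hence at a time \<open>\<tau> = \<pi> * (4 * l + 1)\<close> the evolution
  multiplies the lifts by \<open>exp (- \<i> * \<pi> * \<nu> / 2)\<close>, which is the phase that transfers the state in
  \<open>G\<close>, and by \<open>exp\<close> of \<open>\<plusminus> \<i> * \<tau> * sqrt (\<nu>\<^sup>2 + 4) / 2\<close>. State transfer in the corona becomes as good as
  desired if \<open>l\<close> can be chosen such that the second factor is close to one and the same sign for
  all eigenvalues.

  This is a problem of simultaneous Diophantine approximation. The square roots of distinct
  squarefree numbers are linearly independent over the rationals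
  (\<open>sqrt_squarefree_independent\<close>), so by Kronecker's theorem the multiples \<open>l * sqrt c\<close>, for
  finitely many squarefree \<open>c > 1\<close>, approximate prescribed numbers modulo one. If all \<open>\<nu>\<close> are odd,
  this makes the second factor close to \<open>1\<close>; if all are even, it can be made close to \<open>- 1\<close>, even
  for \<open>\<nu> = 0\<close>, where it is exactly \<open>- 1\<close> (\<open>simultaneous_phases\<close>). The reduction from state transfer to
  this approximation is \<open>pretty_good_state_transfer_corona\<close>.

  For the cubes and halved cubes, the eigenvectors are the characters of the group of binary
  words, and the component of a word along the character of \<open>S\<close> differs from that of the
  complementary word by the sign \<open>(- 1) ^ card S\<close>. For the cocktail party graphs three
  eigencomponents suffice. In each family antipodality is reduced to being complementary words,
  or the two vertices of a non-adjacent pair, by bounding distances from both sides.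
\<close>

section \<open>Square roots of squarefree numbers are linearly independent over the rationals\<close>

text \<open>Subfields of the real numbers, as sets.\<close>

definition real_subfield :: "real set \<Rightarrow> bool" where
  "real_subfield F \<longleftrightarrow> 1 \<in> F \<and> (\<forall>x\<in>F. \<forall>y\<in>F. x - y \<in> F \<and> x * y \<in> F \<and> inverse x \<in> F)"

lemma real_subfieldD:
  assumes "real_subfield F"
  shows real_subfield_0: "0 \<in> F" and real_subfield_1: "1 \<in> F"
    and real_subfield_minus: "x \<in> F \<Longrightarrow> - x \<in> F"
    and real_subfield_diff: "x \<in> F \<Longrightarrow> y \<in> F \<Longrightarrow> x - y \<in> F"
    and real_subfield_add: "x \<in> F \<Longrightarrow> y \<in> F \<Longrightarrow> x + y \<in> F"
    and real_subfield_mult: "x \<in> F \<Longrightarrow> y \<in> F \<Longrightarrow> x * y \<in> F"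
    and real_subfield_inverse: "x \<in> F \<Longrightarrow> inverse x \<in> F"
    and real_subfield_divide: "x \<in> F \<Longrightarrow> y \<in> F \<Longrightarrow> x / y \<in> F"
proof -
  have diff: "x \<in> F \<Longrightarrow> y \<in> F \<Longrightarrow> x - y \<in> F" for x y
    using assms by (auto simp: real_subfield_def)
  show one: "1 \<in> F" using assms by (auto simp: real_subfield_def)
  show zero: "0 \<in> F" using diff[OF one one] by simp
  show minus: "x \<in> F \<Longrightarrow> - x \<in> F" for x using diff[OF zero, of x] by simp
  show "x \<in> F \<Longrightarrow> y \<in> F \<Longrightarrow> x + y \<in> F" using diff[OF _ minus, of x y] by simp
  show "x \<in> F \<Longrightarrow> y \<in> F \<Longrightarrow> x - y \<in> F" by (rule diff)
  show "x \<in> F \<Longrightarrow> y \<in> F \<Longrightarrow> x * y \<in> F" "x \<in> F \<Longrightarrow> inverse x \<in> F"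
    "x \<in> F \<Longrightarrow> y \<in> F \<Longrightarrow> x / y \<in> F"
    using assms by (auto simp: real_subfield_def divide_inverse)
qed

lemma real_subfield_Rats: "real_subfield \<rat>"
  by (auto simp: real_subfield_def)

text \<open>The extension of a field \<open>F\<close> by the square root of \<open>p\<close>.\<close>

definition adjoin_sqrt :: "nat \<Rightarrow> real set \<Rightarrow> real set" where
  "adjoin_sqrt p F = {a + b * sqrt (real p) | a b. a \<in> F \<and> b \<in> F}"

lemma subset_adjoin_sqrt: "real_subfield F \<Longrightarrow> F \<subseteq> adjoin_sqrt p F"
  unfolding adjoin_sqrt_def by (force dest: real_subfield_0)

lemma real_subfield_of_nat: "real_subfield F \<Longrightarrow> real n \<in> F"
  by (induction n) (auto dest: real_subfieldD)

lemma real_subfield_adjoin_sqrt: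
  assumes F: "real_subfield F"
  shows "real_subfield (adjoin_sqrt p F)"
proof -
  note cl = real_subfieldD[OF F] real_subfield_of_nat[OF F]
  let ?r = "sqrt (real p)"
  have mem: "a + b * ?r \<in> adjoin_sqrt p F" if "a \<in> F" "b \<in> F" for a b
    using that by (auto simp: adjoin_sqrt_def)
  have sub: "x \<in> adjoin_sqrt p F" if "x \<in> F" for x
    using subset_adjoin_sqrt[OF F] that by blast
  have "inverse (a + b * ?r) \<in> adjoin_sqrt p F" if ab: "a \<in> F" "b \<in> F" for a b
  proof (cases "a\<^sup>2 - real p * b\<^sup>2 = 0")
    case True
    show ?thesis
    proof (cases "b = 0")
      case True
      then show ?thesis using ab sub cl by auto
    next
      case False
      \<comment> \<open>Here \<open>p\<close> already has a square root in \<open>F\<close>.\<close>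
      from True have "(a / b)\<^sup>2 = real p"
        using False by (simp add: field_simps)
      then have "?r = \<bar>a / b\<bar>" by (metis real_sqrt_abs)
      then have "?r \<in> F" using ab cl by (auto simp: abs_if)
      then show ?thesis using ab cl by (intro sub) auto
    qed
  next
    case False
    let ?N = "a\<^sup>2 - real p * b\<^sup>2"
    have N: "(a + b * ?r) * (a - b * ?r) = ?N"
      by (simp add: algebra_simps power2_eq_square)
    have "inverse (a + b * ?r) = (a - b * ?r) / ?N"
      by (rule inverse_unique) (use N False in simp)
    also have "\<dots> = a / ?N + (- b / ?N) * ?r"
      by (simp add: diff_divide_distrib)
    finally show ?thesis
      using ab cl mem[of "a / ?N" "- b / ?N"] by (auto simp: power2_eq_square)
  qed
  moreover have "(a + b * ?r) * (c + d * ?r) \<in> adjoin_sqrt p F"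
    if "a \<in> F" "b \<in> F" "c \<in> F" "d \<in> F" for a b c d
  proof -
    have "(a + b * ?r) * (c + d * ?r) = (a * c + b * d * real p) + (a * d + b * c) * ?r"
      by (simp add: algebra_simps)
    then show ?thesis using that cl mem by metis
  qed
  moreover have "(a + b * ?r) - (c + d * ?r) \<in> adjoin_sqrt p F"
    if "a \<in> F" "b \<in> F" "c \<in> F" "d \<in> F" for a b c d
  proof -
    have "(a + b * ?r) - (c + d * ?r) = (a - c) + (b - d) * ?r"
      by (simp add: algebra_simps)
    then show ?thesis using that cl mem by metis
  qed
  moreover have "1 \<in> adjoin_sqrt p F" using sub cl by blast
  moreover have "\<exists>a\<in>F. \<exists>b\<in>F. x = a + b * ?r" if "x \<in> adjoin_sqrt p F" for x
    using that by (auto simp: adjoin_sqrt_def)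
  ultimately show ?thesis
    unfolding real_subfield_def by metis
qed

text \<open>The field generated by the square roots of the members of \<open>ps\<close>.\<close>

primrec sqrt_field :: "nat list \<Rightarrow> real set" where
  "sqrt_field [] = \<rat>"
| "sqrt_field (p # ps) = adjoin_sqrt p (sqrt_field ps)"

lemma real_subfield_sqrt_field: "real_subfield (sqrt_field ps)"
  by (induction ps) (auto intro: real_subfield_Rats real_subfield_adjoin_sqrt)

lemma sqrt_squarefree_irrational:
  fixes t :: nat
  assumes "squarefree t" "t > 1"
  shows "sqrt (real t) \<notin> \<rat>"
proof
  assume "sqrt (real t) \<in> \<rat>"
  then obtain m n :: nat where n: "n \<noteq> 0" and eq: "\<bar>sqrt (real t)\<bar> = real m / real n"
    and co: "coprime m n"
    by (rule Rats_abs_nat_div_natE)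
  have "real m = sqrt (real t) * real n"
    using n eq by (simp add: field_simps)
  then have "real (m\<^sup>2) = real (t * n\<^sup>2)"
    by (simp add: power_mult_distrib)
  then have eq2: "m\<^sup>2 = t * n\<^sup>2" by linarith
  then have "n\<^sup>2 dvd m\<^sup>2" by simp
  then have "n dvd m" by simp
  then have "n = 1" using co by (simp add: coprime_absorb_right)
  then have "m\<^sup>2 dvd t" using eq2 by simp
  then have "m = 1" using assms(1) squarefreeD by fastforce
  then show False using eq2 \<open>n = 1\<close> assms by simp
qed

lemma squarefree_times_prime:
  fixes p t :: nat
  assumes "prime p" "squarefree t" "\<not> p dvd t"
  shows "squarefree (p * t)"
  using assms by (intro squarefree_mult_coprime) (auto intro: squarefree_prime prime_imp_coprime)

text \<open>
  This is the inductive core of the independence of square roots: squaring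
  \<open>sqrt t = a + b * sqrt p\<close> puts \<open>sqrt p\<close>, \<open>sqrt t\<close> or \<open>sqrt (p * t)\<close> into the smaller field.
\<close>

lemma sqrt_notin_sqrt_field:
  fixes t :: nat
  assumes "distinct ps" "\<forall>p\<in>set ps. prime p" "squarefree t" "t > 1" "\<forall>p\<in>set ps. \<not> p dvd t"
  shows "sqrt (real t) \<notin> sqrt_field ps"
  using assms
proof (induction ps arbitrary: t)
  case Nil
  then show ?case by (simp add: sqrt_squarefree_irrational)
next
  case (Cons p ps)
  note F = real_subfield_sqrt_field[of ps]
  note cl = real_subfieldD[OF F] real_subfield_of_nat[OF F]
  have p: "prime p" "p > 1" using Cons.prems prime_gt_1_nat by auto
  have p_notin: "sqrt (real p) \<notin> sqrt_field ps"
    using Cons.prems p by (intro Cons.IH) (auto intro: squarefree_prime dest: primes_dvd_imp_eq)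
  have t_notin: "sqrt (real t) \<notin> sqrt_field ps"
    using Cons.prems by (intro Cons.IH) auto
  have pt_notin: "sqrt (real (p * t)) \<notin> sqrt_field ps"
  proof (rule Cons.IH)
    show "\<forall>q\<in>set ps. \<not> q dvd p * t"
      using Cons.prems p by (auto simp: prime_dvd_mult_iff dest: primes_dvd_imp_eq)
    show "1 < p * t" using less_1_mult[OF p(2)] Cons.prems(4) .
  qed (use Cons.prems p squarefree_times_prime in auto)
  show ?case
  proof
    assume "sqrt (real t) \<in> sqrt_field (p # ps)"
    then obtain a b where ab: "a \<in> sqrt_field ps" "b \<in> sqrt_field ps"
      and eq: "sqrt (real t) = a + b * sqrt (real p)"
      by (auto simp: adjoin_sqrt_def)
    show False
    proof (cases "b = 0")
      case True
      then show False using eq ab t_notin by simp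
    next
      case b: False
      show False
      proof (cases "a = 0")
        case True
        then have "sqrt (real (p * t)) = b * real p"
          using eq by (simp add: real_sqrt_mult)
        then show False using pt_notin ab cl by metis
      next
        case a: False
        have "real t = (a + b * sqrt (real p))\<^sup>2"
          using eq by (metis of_nat_0_le_iff real_sqrt_pow2)
        also have "\<dots> = a * a + b * b * real p + 2 * a * b * sqrt (real p)"
          by (simp add: power2_sum power_mult_distrib) (simp add: power2_eq_square)
        finally have "sqrt (real p) = (real t - (a * a + b * b * real p)) / (real 2 * a * b)"
          using a b by (simp add: field_simps)
        moreover have "\<dots> \<in> sqrt_field ps"
          by (intro cl ab)
        ultimately show False using p_notin by simp
      qed
    qed
  qed
qed

lemma sqrt_in_sqrt_field:
  fixes c :: nat
  assumes "\<forall>p\<in>set ps. prime p" "squarefree c" "prime_factors c \<subseteq> set ps"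
  shows "sqrt (real c) \<in> sqrt_field ps"
  using assms
proof (induction ps arbitrary: c)
  case Nil
  then have "c = 1" using prime_factorization_empty_iff[of c] by auto
  then show ?case by simp
next
  case (Cons p ps)
  note F = real_subfield_sqrt_field[of ps]
  have c0: "c \<noteq> 0" using Cons.prems(2) by (metis not_squarefree_0)
  show ?case
  proof (cases "p dvd c")
    case False
    then have "prime_factors c \<subseteq> set ps"
      using Cons.prems by (auto simp: prime_factors_dvd)
    then show ?thesis
      using Cons subset_adjoin_sqrt[OF F, of p] by auto
  next
    case True
    then obtain e where e: "c = p * e" by blast
    have "\<not> p dvd e"
    proof
      assume "p dvd e"
      then have "p\<^sup>2 dvd c" by (auto simp: e power2_eq_square)
      then have "p dvd 1" using squarefreeD Cons.prems by blast
      then show False using Cons.prems by auto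
    qed
    then have "prime_factors e \<subseteq> set ps"
      using Cons.prems c0 by (auto simp: e prime_factors_dvd)
    then have "sqrt (real e) \<in> sqrt_field ps"
      using Cons.prems squarefree_multD(2)[of p e] by (intro Cons.IH) (auto simp: e)
    then show ?thesis
      using real_subfield_0[OF F] by (force simp: e adjoin_sqrt_def real_sqrt_mult)
  qed
qed

lemma sum_in_real_subfield:
  assumes "real_subfield F" "\<And>x. x \<in> A \<Longrightarrow> f x \<in> F"
  shows "sum f A \<in> F"
  using assms by (induction A rule: infinite_finite_induct) (auto dest: real_subfieldD)

lemma Rats_subset_sqrt_field: "\<rat> \<subseteq> sqrt_field ps"
proof (induction ps)
  case (Cons p ps)
  then show ?case using subset_adjoin_sqrt[OF real_subfield_sqrt_field, of ps p] by simp
qed simp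

lemma sqrt_squarefree_independent_aux:
  fixes C :: "nat set" and a :: "nat \<Rightarrow> real"
  assumes "distinct ps" "\<forall>p\<in>set ps. prime p"
    and "finite C" "\<forall>c\<in>C. squarefree c \<and> prime_factors c \<subseteq> set ps" "\<forall>c\<in>C. a c \<in> \<rat>"
    and "(\<Sum>c\<in>C. a c * sqrt (real c)) = 0"
  shows "\<forall>c\<in>C. a c = 0"
  using assms
proof (induction ps arbitrary: C a)
  case Nil
  have "c = 1" if "c \<in> C" for c
    using Nil.prems(4) that prime_factorization_empty_iff[of c] by auto
  then have "C \<subseteq> {1}" by blast
  then consider "C = {}" | "C = {1}" by blast
  then show ?case using Nil.prems by cases auto
next
  case (Cons p ps)
  note F = real_subfield_sqrt_field[of ps]
  have p: "prime p" "p > 1" using Cons.prems prime_gt_1_nat by auto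
  define C1 where "C1 = {c\<in>C. \<not> p dvd c}"
  define C2 where "C2 = {e. p * e \<in> C}"
  have C: "C = C1 \<union> (*) p ` C2" "C1 \<inter> (*) p ` C2 = {}"
    by (auto simp: C1_def C2_def)
  have inj: "inj_on ((*) p) C2" using p by (auto simp: inj_on_def)
  have "finite ((*) p ` C2)" using Cons.prems(3) C(1) by simp
  then have fin: "finite C1" "finite C2"
    using Cons.prems(3) inj finite_imageD by (auto simp: C1_def)
  have C1: "\<forall>c\<in>C1. squarefree c \<and> prime_factors c \<subseteq> set ps"
    using Cons.prems by (auto simp: C1_def prime_factors_dvd)
  have C2: "\<forall>e\<in>C2. squarefree e \<and> prime_factors e \<subseteq> set ps"
  proof
    fix e assume e: "e \<in> C2"
    then have sq: "squarefree (p * e)" and pf: "prime_factors (p * e) \<subseteq> set (p # ps)"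
      using Cons.prems by (auto simp: C2_def)
    have "\<not> p dvd e"
    proof
      assume "p dvd e"
      then have "p\<^sup>2 dvd p * e" by (auto simp: power2_eq_square)
      then show False using squarefreeD[OF sq] p by auto
    qed
    moreover have "e \<noteq> 0" using sq by (metis mult_0_right not_squarefree_0)
    ultimately show "squarefree e \<and> prime_factors e \<subseteq> set ps"
      using sq pf p by (auto simp: prime_factors_dvd dest: squarefree_multD)
  qed
  define X where "X = (\<Sum>c\<in>C1. a c * sqrt (real c))"
  define Y where "Y = (\<Sum>e\<in>C2. a (p * e) * sqrt (real e))"
  have X: "X \<in> sqrt_field ps"
    unfolding X_def using C1 Cons.prems Rats_subset_sqrt_field[of ps] C
    by (intro sum_in_real_subfield[OF F] real_subfield_mult[OF F] sqrt_in_sqrt_field) auto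
  have Y: "Y \<in> sqrt_field ps"
    unfolding Y_def using C2 Cons.prems Rats_subset_sqrt_field[of ps] C
    by (intro sum_in_real_subfield[OF F] real_subfield_mult[OF F] sqrt_in_sqrt_field) auto
  have "0 = X + (\<Sum>c\<in>(*) p ` C2. a c * sqrt (real c))"
    using Cons.prems fin C unfolding X_def by (metis finite_imageI sum.union_disjoint)
  also have "(\<Sum>c\<in>(*) p ` C2. a c * sqrt (real c)) = Y * sqrt (real p)"
    unfolding Y_def by (subst sum.reindex[OF inj])
      (simp add: sum_distrib_left real_sqrt_mult mult_ac)
  finally have XY: "X + Y * sqrt (real p) = 0" by simp
  have "Y = 0"
  proof (rule ccontr)
    assume "Y \<noteq> 0"
    then have "sqrt (real p) = - X / Y" using XY by (simp add: field_simps)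
    then have "sqrt (real p) \<in> sqrt_field ps"
      using X Y real_subfieldD[OF F] by auto
    moreover have "sqrt (real p) \<notin> sqrt_field ps"
      using Cons.prems p
      by (intro sqrt_notin_sqrt_field) (auto intro: squarefree_prime dest: primes_dvd_imp_eq)
    ultimately show False by blast
  qed
  then have "X = 0" using XY by simp
  have "\<forall>c\<in>C1. a c = 0"
    by (rule Cons.IH) (use Cons.prems fin C1 C \<open>X = 0\<close> in \<open>auto simp: X_def\<close>)
  moreover have "\<forall>e\<in>C2. a (p * e) = 0"
    by (rule Cons.IH) (use Cons.prems fin C2 C \<open>Y = 0\<close> in \<open>auto simp: Y_def\<close>)
  ultimately show ?case using C by auto
qed

lemma sqrt_squarefree_independent:
  fixes C :: "nat set" and a :: "nat \<Rightarrow> real"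
  assumes "finite C" "\<forall>c\<in>C. squarefree c" "\<forall>c\<in>C. a c \<in> \<rat>"
    and "(\<Sum>c\<in>C. a c * sqrt (real c)) = 0" and "c \<in> C"
  shows "a c = 0"
proof -
  define P where "P = (\<Union>c\<in>C. prime_factors c)"
  obtain ps where ps: "set ps = P" "distinct ps"
    using finite_distinct_list[of P] assms(1) by (auto simp: P_def)
  have "\<forall>c\<in>C. a c = 0"
    by (rule sqrt_squarefree_independent_aux[of ps]) (use assms ps in \<open>auto simp: P_def\<close>)
  then show ?thesis using assms by blast
qed

section \<open>Simultaneous approximation\<close>

lemma Kronecker_sqrt_squarefree:
  fixes C :: "nat set" and \<alpha> :: "nat \<Rightarrow> real"
  assumes C: "finite C" "\<forall>c\<in>C. squarefree c \<and> c \<noteq> 1" and "\<epsilon> > 0"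
  obtains k :: int where "\<forall>c\<in>C. \<exists>m::int. \<bar>of_int k * sqrt (real c) - of_int m - \<alpha> c\<bar> < \<epsilon>"
proof -
  obtain e where e: "bij_betw e {0..<card C} C"
    using ex_bij_betw_nat_finite[OF C(1)] by blast
  define n where "n = card C"
  define d where "d i = (if i < n then e i else 1)" for i
  have eC: "e i \<in> C" if "i < n" for i
    using e that by (auto simp: n_def bij_betw_def)
  have d_image: "d ` {..n} \<subseteq> insert 1 C"
    using eC by (auto simp: d_def)
  have inj_d: "inj_on d {..n}"
  proof (rule inj_onI)
    fix i j assume ij: "i \<in> {..n}" "j \<in> {..n}" "d i = d j"
    have d1: "d k = 1 \<longleftrightarrow> \<not> k < n" for k
      using eC[of k] C(2) by (auto simp: d_def)
    show "i = j"
    proof (cases "i < n")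
      case True
      then have "j < n" using d1 ij(3) by metis
      moreover have "inj_on e {0..<n}" using e by (simp add: n_def bij_betw_def)
      ultimately show ?thesis using True ij(3) by (simp add: d_def inj_on_def)
    next
      case False
      then have "\<not> j < n" using d1 ij(3) by metis
      then show ?thesis using False ij by simp
    qed
  qed
  define \<theta> where "\<theta> i = sqrt (real (d i))" for i
  interpret Modules.module "\<lambda>r x. real_of_int r * x"
    by (simp add: Modules.module.intro distrib_left mult.commute)
  have inj_sqrt: "inj_on (\<lambda>c. sqrt (real c)) D" for D
    by (auto simp: inj_on_def)
  have indep: "independent (\<theta> ` {..n})"
    unfolding independent_explicit_module
  proof (intro allI impI)
    fix t and u :: "real \<Rightarrow> int" and v
    assume t: "finite t" "t \<subseteq> \<theta> ` {..n}" "(\<Sum>v\<in>t. real_of_int (u v) * v) = 0" "v \<in> t"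
    have "t \<subseteq> (\<lambda>c. sqrt (real c)) ` insert 1 C"
      using t(2) d_image unfolding \<theta>_def by blast
    then obtain D where D: "D \<subseteq> insert 1 C" "t = (\<lambda>c. sqrt (real c)) ` D"
      by (meson subset_imageE)
    then obtain c where c: "c \<in> D" "v = sqrt (real c)" using t(4) by auto
    have "real_of_int (u (sqrt (real c))) = 0"
    proof (rule sqrt_squarefree_independent[of D "\<lambda>c. real_of_int (u (sqrt (real c)))"])
      show "finite D" using D C(1) finite_subset by blast
      show "\<forall>c\<in>D. squarefree c" using D C(2) by auto
      show "(\<Sum>c\<in>D. real_of_int (u (sqrt (real c))) * sqrt (real c)) = 0"
        using t(3) unfolding D(2) by (subst (asm) sum.reindex[OF inj_sqrt]) (simp add: o_def)
    qed (use c in auto)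
    then show "u v = 0" using c by simp
  qed
  have inj_\<theta>: "inj_on \<theta> {..n}"
    using inj_d by (auto simp: \<theta>_def inj_on_def)
  have "\<theta> n = 1" by (simp add: \<theta>_def d_def)
  then obtain k m where km: "\<And>i. i < n \<Longrightarrow> \<bar>of_int k * \<theta> i - of_int (m i) - \<alpha> (d i)\<bar> < \<epsilon>"
    using Kronecker_thm_2[OF indep inj_\<theta> _ \<open>\<epsilon> > 0\<close>, of "\<lambda>i. \<alpha> (d i)"] by metis
  have "\<exists>m::int. \<bar>of_int k * sqrt (real c) - of_int m - \<alpha> c\<bar> < \<epsilon>" if "c \<in> C" for c
  proof -
    have "C = e ` {..<n}" using e by (simp add: bij_betw_def n_def lessThan_atLeast0)
    then obtain i where i: "i < n" "c = e i" using \<open>c \<in> C\<close> by auto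
    then show ?thesis using km[of i] by (auto simp: \<theta>_def d_def)
  qed
  then show ?thesis using that by blast
qed

lemma norm_cis_diff_le: "norm (cis x - cis y) \<le> \<bar>x - y\<bar>"
proof -
  have "cis x - cis y = cis y * (cis (x - y) - 1)"
    by (simp add: cis_mult right_diff_distrib)
  then have "norm (cis x - cis y) = 2 * \<bar>sin ((x - y) / 2)\<bar>"
    using dist_exp_i_1[of "x - y"] by (simp add: norm_mult cis_conv_exp)
  also have "\<dots> \<le> \<bar>x - y\<bar>"
    using abs_sin_x_le_abs_x[of "(x - y) / 2"] by simp
  finally show ?thesis .
qed

text \<open>
  Write \<open>\<nu>\<^sup>2 + 4 = c * B\<^sup>2\<close> with \<open>c\<close> squarefree. For odd \<open>\<nu>\<close> the factor \<open>c\<close> is never \<open>1\<close>, and the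
  multiplier \<open>4 * l + 1\<close> is chosen with \<open>(4 * l + 1) * sqrt c\<close> close to \<open>0\<close> modulo \<open>4\<close>. For even
  \<open>\<nu>\<close> one has \<open>B = 2\<close> modulo \<open>4\<close>, and \<open>(4 * l + 1) * sqrt c\<close> is made close to \<open>1\<close> modulo \<open>4\<close>, which
  is automatic for \<open>c = 1\<close>.
\<close>

lemma simultaneous_phases:
  fixes L :: "int set"
  assumes L: "finite L" and parity: "(\<forall>\<nu>\<in>L. even \<nu>) \<or> (\<forall>\<nu>\<in>L. odd \<nu>)" and \<delta>: "\<delta> > 0"
  obtains l :: int and \<kappa> :: complex where "\<kappa> = 1 \<or> \<kappa> = - 1"
    and "\<forall>\<nu>\<in>L. norm (cis (pi * of_int (4 * l + 1) * sqrt (of_int (\<nu>\<^sup>2 + 4)) / 2) - \<kappa>) < \<delta>"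
proof -
  define N where "N \<nu> = nat (\<nu>\<^sup>2 + 4)" for \<nu> :: int
  define c where "c \<nu> = squarefree_part (N \<nu>)" for \<nu>
  define B where "B \<nu> = square_part (N \<nu>)" for \<nu>
  have N: "int (N \<nu>) = \<nu>\<^sup>2 + 4" for \<nu> by (simp add: N_def)
  have N_eq: "N \<nu> = c \<nu> * (B \<nu>)\<^sup>2" for \<nu>
    unfolding c_def B_def by (rule squarefree_decompose)
  have sqrt_N: "sqrt (of_int (\<nu>\<^sup>2 + 4)) = real (B \<nu>) * sqrt (real (c \<nu>))" for \<nu>
  proof -
    have "real_of_int (\<nu>\<^sup>2 + 4) = real (c \<nu> * (B \<nu>)\<^sup>2)"
      by (metis N N_eq of_int_of_nat_eq)
    then show ?thesis by (simp add: real_sqrt_mult)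
  qed
  define r where "r = (if \<forall>\<nu>\<in>L. even \<nu> then 1 else 0 :: int)"
  define S where "S = (\<Sum>\<nu>\<in>L. B \<nu>) + 1"
  have BS: "B \<nu> < S" if "\<nu> \<in> L" for \<nu>
    using member_le_sum[of \<nu> L B] that L by (auto simp: S_def)
  have S: "S > 0" by (simp add: S_def)
  define \<epsilon> where "\<epsilon> = \<delta> / (2 * pi * real S)"
  have \<epsilon>: "\<epsilon> > 0" using \<delta> S by (simp add: \<epsilon>_def)
  obtain l :: int where l: "\<forall>c\<in>c ` L - {1}. \<exists>m::int.
      \<bar>of_int l * sqrt (real c) - of_int m - (of_int r - sqrt (real c)) / 4\<bar> < \<epsilon>"
    by (rule Kronecker_sqrt_squarefree[of "c ` L - {1}" \<epsilon> "\<lambda>c. (of_int r - sqrt (real c)) / 4"])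
      (use L \<epsilon> in \<open>auto simp: c_def\<close>)
  have c1: "r = 1" if "\<nu> \<in> L" "c \<nu> = 1" for \<nu>
  proof (rule ccontr)
    assume "r \<noteq> 1"
    then have "odd \<nu>" using parity that by (auto simp: r_def split: if_splits)
    have eq: "(int (B \<nu>))\<^sup>2 = \<nu>\<^sup>2 + 4"
      using N_eq[of \<nu>] N[of \<nu>] that by simp
    then have "even ((int (B \<nu>))\<^sup>2) = even \<nu>" by simp
    then have "odd (int (B \<nu>))" using \<open>odd \<nu>\<close> by simp
    have sq8: "x\<^sup>2 mod 8 = 1" if "odd x" for x :: int
    proof -
      have "x mod 8 \<in> {1, 3, 5, 7}" using that by auto presburger
      moreover have "x\<^sup>2 mod 8 = (x mod 8)\<^sup>2 mod 8" by (simp add: power_mod)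
      ultimately show ?thesis by auto
    qed
    have "(\<nu>\<^sup>2 + 4) mod 8 = 5"
      using sq8[OF \<open>odd \<nu>\<close>] by presburger
    then show False using sq8[OF \<open>odd (int (B \<nu>))\<close>] eq by simp
  qed
  have approx: "\<exists>m::int. \<bar>of_int (4 * l + 1) * sqrt (real (c \<nu>)) - of_int (4 * m + r)\<bar> < 4 * \<epsilon>"
    if "\<nu> \<in> L" for \<nu>
  proof (cases "c \<nu> = 1")
    case True
    then show ?thesis using c1[OF that] \<epsilon> by (intro exI[of _ l]) simp
  next
    case False
    then have "c \<nu> \<in> c ` L - {1}" using that by simp
    from bspec[OF l this] obtain m :: int where
      "\<bar>of_int l * sqrt (real (c \<nu>)) - of_int m - (of_int r - sqrt (real (c \<nu>))) / 4\<bar> < \<epsilon>"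
      by blast
    moreover have "of_int (4 * l + 1) * sqrt (real (c \<nu>)) - of_int (4 * m + r) =
        4 * (of_int l * sqrt (real (c \<nu>)) - of_int m - (of_int r - sqrt (real (c \<nu>))) / 4)"
      by (simp add: field_simps)
    ultimately show ?thesis by (intro exI[of _ m]) (simp only: abs_mult, simp)
  qed
  have phase: "cis (pi / 2 * real (B \<nu>) * of_int (4 * m + r)) = (if r = 1 then - 1 else 1)"
    if "\<nu> \<in> L" for \<nu> and m :: int
  proof (cases "r = 1")
    case False
    then have "r = 0" by (auto simp: r_def split: if_splits)
    then have "pi / 2 * real (B \<nu>) * of_int (4 * m + r) = 2 * pi * of_int (int (B \<nu>) * m)"
      by simp
    then show ?thesis using \<open>r = 0\<close> by (simp only: cis_multiple_2pi[OF Ints_of_int]) simp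
  next
    case True
    then have "even \<nu>" using that by (auto simp: r_def split: if_splits)
    then obtain j where j: "\<nu> = 2 * j" by blast
    then have "int (N \<nu>) = int (4 * nat (j\<^sup>2 + 1))" by (simp add: N power2_eq_square)
    then have N4: "N \<nu> = 4 * nat (j\<^sup>2 + 1)" by linarith
    then have "2\<^sup>2 dvd N \<nu>" by simp
    then have "2 dvd B \<nu>" unfolding B_def by (simp only: dvd_square_part_iff)
    then obtain b where b: "B \<nu> = 2 * b" by blast
    have "odd b"
    proof
      assume "even b"
      then obtain b' where "b = 2 * b'" by blast
      then have "nat (j\<^sup>2 + 1) = 4 * (c \<nu> * b'\<^sup>2)"
        using N4 N_eq[of \<nu>] b by (simp add: power2_eq_square mult_ac)
      then have "4 dvd nat (j\<^sup>2 + 1)" by simp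
      then have dvd4: "4 dvd j\<^sup>2 + 1"
        using int_dvd_int_iff[of 4 "nat (j\<^sup>2 + 1)"] by simp
      have "j mod 4 \<in> {0, 1, 2, 3}" by auto
      moreover have "j\<^sup>2 mod 4 = (j mod 4)\<^sup>2 mod 4" by (simp add: power_mod)
      ultimately have "j\<^sup>2 mod 4 = 0 \<or> j\<^sup>2 mod 4 = 1" by auto
      then show False using dvd4 by presburger
    qed
    then obtain b' where b': "b = 2 * b' + 1" by (elim oddE)
    have "pi / 2 * real (B \<nu>) * of_int (4 * m + r) =
        pi + 2 * pi * of_int (int b' + 2 * m * int b)"
      unfolding True b by (simp add: b' algebra_simps)
    then show ?thesis
      by (simp only: cis_mult[symmetric] cis_multiple_2pi[OF Ints_of_int]) (simp add: True)
  qed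
  show ?thesis
  proof (rule that[of "if r = 1 then - 1 else 1"])
    show "\<forall>\<nu>\<in>L. norm (cis (pi * of_int (4 * l + 1) * sqrt (of_int (\<nu>\<^sup>2 + 4)) / 2)
        - (if r = 1 then - 1 else 1)) < \<delta>"
    proof
      fix \<nu> assume \<nu>: "\<nu> \<in> L"
      let ?s = "sqrt (real (c \<nu>))"
      obtain m :: int where m: "\<bar>of_int (4 * l + 1) * ?s - of_int (4 * m + r)\<bar> < 4 * \<epsilon>"
        using approx[OF \<nu>] by blast
      have "norm (cis (pi * of_int (4 * l + 1) * sqrt (of_int (\<nu>\<^sup>2 + 4)) / 2)
          - (if r = 1 then - 1 else 1)) =
        norm (cis (pi / 2 * real (B \<nu>) * (of_int (4 * l + 1) * ?s))
          - cis (pi / 2 * real (B \<nu>) * of_int (4 * m + r)))"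
        unfolding phase[OF \<nu>] sqrt_N by (simp add: mult_ac)
      also have "\<dots> \<le> \<bar>pi / 2 * real (B \<nu>) * (of_int (4 * l + 1) * ?s)
          - pi / 2 * real (B \<nu>) * of_int (4 * m + r)\<bar>"
        by (rule norm_cis_diff_le)
      also have "\<dots> = pi / 2 * real (B \<nu>) * \<bar>of_int (4 * l + 1) * ?s - of_int (4 * m + r)\<bar>"
        by (simp only: right_diff_distrib[symmetric] abs_mult) simp
      also have "\<dots> \<le> pi / 2 * real (B \<nu>) * (4 * \<epsilon>)"
        using m by (intro mult_left_mono) auto
      also have "\<dots> < pi / 2 * real S * (4 * \<epsilon>)"
        using BS[OF \<nu>] \<epsilon> by (intro mult_strict_right_mono mult_strict_left_mono) auto
      also have "\<dots> = \<delta>"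
        using S by (simp add: \<epsilon>_def field_simps)
      finally show "norm (cis (pi * of_int (4 * l + 1) * sqrt (of_int (\<nu>\<^sup>2 + 4)) / 2)
        - (if r = 1 then - 1 else 1)) < \<delta>" .
    qed
  qed auto
qed

section \<open>State transfer and eigenvectors\<close>

text \<open>
  A vector is a function on all of the vertex type, but only its values on the vertices of the
  graph count. The zero vector is not excluded.
\<close>

definition eigenvector :: "'a pair_pre_digraph \<Rightarrow> ('a \<Rightarrow> complex) \<Rightarrow> complex \<Rightarrow> bool" where
  "eigenvector G f \<theta> \<longleftrightarrow>
    (\<forall>x\<in>pverts G. (\<Sum>y\<in>pverts G. adjacency_matrix G x y * f y) = \<theta> * f x)"

lemma matrix_power_eigenvector:
  assumes V: "finite V" and ev: "\<forall>x\<in>V. (\<Sum>y\<in>V. M x y * f y) = \<theta> * f x" and "x \<in> V"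
  shows "(\<Sum>y\<in>V. matrix_power V M k x y * f y) = \<theta> ^ k * f x"
  using \<open>x \<in> V\<close>
proof (induction k arbitrary: x)
  case 0
  have "(\<Sum>y\<in>V. matrix_power V M 0 x y * f y) = (\<Sum>y\<in>V. if x = y then f y else 0)"
    by (intro sum.cong) auto
  then show ?case using V 0 by simp
next
  case (Suc k)
  have "(\<Sum>y\<in>V. matrix_power V M (Suc k) x y * f y)
      = (\<Sum>y\<in>V. \<Sum>z\<in>V. M x z * (matrix_power V M k z y * f y))"
    by (simp add: sum_distrib_right mult.assoc)
  also have "\<dots> = (\<Sum>z\<in>V. M x z * (\<Sum>y\<in>V. matrix_power V M k z y * f y))"
    by (subst sum.swap) (simp add: sum_distrib_left)
  also have "\<dots> = (\<Sum>z\<in>V. \<theta> ^ k * (M x z * f z))"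
    by (intro sum.cong) (simp_all add: Suc.IH)
  also have "\<dots> = \<theta> ^ Suc k * f x"
    using ev Suc.prems by (simp flip: sum_distrib_left)
  finally show ?case .
qed

lemma matrix_exp_eigenvector:
  assumes V: "finite V" and ev: "\<forall>x\<in>V. (\<Sum>y\<in>V. M x y * f y) = \<theta> * f x" and x: "x \<in> V"
  shows "matrix_vector V (matrix_exp V M) f x = exp \<theta> * f x"
proof -
  have "(\<lambda>k. \<Sum>y\<in>V. matrix_power V M k x y / fact k * f y) sums (\<Sum>y\<in>V. matrix_exp V M x y * f y)"
    unfolding matrix_exp_def
    by (intro sums_sum sums_mult2 summable_sums summable_matrix_exp V x)
  moreover have "(\<Sum>y\<in>V. matrix_power V M k x y / fact k * f y) = \<theta> ^ k /\<^sub>R fact k * f x" for k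
  proof -
    have "(\<Sum>y\<in>V. matrix_power V M k x y / fact k * f y)
        = (\<Sum>y\<in>V. matrix_power V M k x y * f y) / fact k"
      by (simp add: sum_divide_distrib)
    then show ?thesis
      using matrix_power_eigenvector[OF V ev x]
      by (simp add: scaleR_conv_of_real divide_inverse mult_ac)
  qed
  ultimately have "(\<lambda>k. \<theta> ^ k /\<^sub>R fact k * f x) sums (\<Sum>y\<in>V. matrix_exp V M x y * f y)"
    by simp
  moreover have "(\<lambda>k. \<theta> ^ k /\<^sub>R fact k * f x) sums (exp \<theta> * f x)"
    by (intro sums_mult2 exp_converges)
  ultimately show ?thesis
    unfolding matrix_vector_def by (rule sums_unique2)
qed

lemma transition_matrix_eigenvector:
  assumes "finite (pverts X)" "eigenvector X f (of_real \<theta>)" "x \<in> pverts X"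
  shows "matrix_vector (pverts X) (transition_matrix X t) f x = cis (- t * \<theta>) * f x"
proof -
  have "\<forall>x\<in>pverts X. (\<Sum>y\<in>pverts X. (- \<i> * of_real t * adjacency_matrix X x y) * f y)
      = (- \<i> * of_real t * of_real \<theta>) * f x"
    using assms(2) unfolding eigenvector_def
    by (simp only: mult.assoc sum_distrib_left[symmetric]) simp
  from matrix_exp_eigenvector[OF assms(1) this assms(3)] show ?thesis
    by (simp add: transition_matrix_def cis_conv_exp mult_ac)
qed

text \<open>
  It suffices to control the phases \<open>exp (- \<i> * \<tau> * \<theta> i)\<close> of the finitely many eigencomponents
  \<open>w i\<close> of the initial state.
\<close>

lemma pretty_good_state_transferI:
  assumes V: "finite (pverts X)" and I: "finite I"
    and ev: "\<And>i. i \<in> I \<Longrightarrow> eigenvector X (w i) (of_real (\<theta> i))"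
    and a: "\<And>x. x \<in> pverts X \<Longrightarrow> basis_vector a x = (\<Sum>i\<in>I. w i x)"
    and b: "\<And>x. x \<in> pverts X \<Longrightarrow> basis_vector b x = (\<Sum>i\<in>I. s i * w i x)"
    and phases: "\<And>\<delta>::real. \<delta> > 0 \<Longrightarrow>
      \<exists>\<tau> \<gamma>. norm \<gamma> = 1 \<and> (\<forall>i\<in>I. norm (cis (- \<tau> * \<theta> i) - \<gamma> * s i) < \<delta>)"
  shows "pretty_good_state_transfer X a b"
  unfolding pretty_good_state_transfer_def
proof (intro allI impI)
  fix \<epsilon> :: real assume \<epsilon>: "\<epsilon> > 0"
  define K where "K = (\<Sum>x\<in>pverts X. \<Sum>i\<in>I. norm (w i x))"
  have K: "K \<ge> 0" unfolding K_def by (intro sum_nonneg) auto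
  define \<delta> where "\<delta> = \<epsilon> / (K + 1)"
  have "\<delta> > 0" using \<epsilon> K by (simp add: \<delta>_def)
  then obtain \<tau> \<gamma> where \<gamma>: "norm \<gamma> = 1"
    and phase: "\<forall>i\<in>I. norm (cis (- \<tau> * \<theta> i) - \<gamma> * s i) < \<delta>"
    using phases by blast
  define R where "R x = matrix_vector (pverts X) (transition_matrix X \<tau>) (basis_vector a) x
    - \<gamma> * basis_vector b x" for x
  have R: "norm (R x) \<le> \<delta> * (\<Sum>i\<in>I. norm (w i x))" if x: "x \<in> pverts X" for x
  proof -
    have "matrix_vector (pverts X) (transition_matrix X \<tau>) (basis_vector a) x
        = (\<Sum>y\<in>pverts X. \<Sum>i\<in>I. transition_matrix X \<tau> x y * w i y)"
      unfolding matrix_vector_def by (intro sum.cong) (simp_all add: a sum_distrib_left)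
    also have "\<dots> = (\<Sum>i\<in>I. matrix_vector (pverts X) (transition_matrix X \<tau>) (w i) x)"
      unfolding matrix_vector_def by (rule sum.swap)
    also have "\<dots> = (\<Sum>i\<in>I. cis (- \<tau> * \<theta> i) * w i x)"
      by (intro sum.cong transition_matrix_eigenvector V ev x refl)
    finally have "R x = (\<Sum>i\<in>I. (cis (- \<tau> * \<theta> i) - \<gamma> * s i) * w i x)"
      unfolding R_def b[OF x] by (simp add: left_diff_distrib sum_subtractf sum_distrib_left mult.assoc)
    also have "norm \<dots> \<le> (\<Sum>i\<in>I. \<delta> * norm (w i x))"
      using phase by (intro sum_norm_le) (simp add: norm_mult mult_right_mono less_imp_le)
    finally show ?thesis by (simp add: sum_distrib_left)
  qed
  have "vector_norm (pverts X) R \<le> (\<Sum>x\<in>pverts X. norm (R x))"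
    unfolding vector_norm_def by (rule L2_set_le_sum) simp
  also have "\<dots> \<le> (\<Sum>x\<in>pverts X. \<delta> * (\<Sum>i\<in>I. norm (w i x)))"
    by (intro sum_mono R)
  also have "\<dots> = \<delta> * K" by (simp add: K_def sum_distrib_left)
  also have "\<dots> < \<epsilon>"
  proof -
    have "\<delta> * K < \<delta> * (K + 1)" using \<open>\<delta> > 0\<close> by (intro mult_strict_left_mono) auto
    also have "\<dots> = \<epsilon>" using K by (simp add: \<delta>_def)
    finally show ?thesis .
  qed
  finally show "\<exists>\<tau> \<gamma>. norm \<gamma> = 1 \<and>
      vector_norm (pverts X) (\<lambda>x. matrix_vector (pverts X) (transition_matrix X \<tau>)
        (basis_vector a) x - \<gamma> * basis_vector b x) < \<epsilon>"
    using \<gamma> unfolding R_def by blast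
qed

section \<open>The corona with a single vertex\<close>

lemma pverts_corona_complete_1:
  "pverts (corona G complete_1) = pverts G \<times> {None, Some ()}"
  by (simp add: corona_def Let_def complete_1_def)

lemma sum_corona_complete_1:
  fixes h :: "'a \<times> unit option \<Rightarrow> complex"
  assumes "finite (pverts G)"
  shows "(\<Sum>p\<in>pverts (corona G complete_1). h p)
    = (\<Sum>y\<in>pverts G. h (y, None)) + (\<Sum>y\<in>pverts G. h (y, Some ()))"
proof -
  have "(\<Sum>p\<in>pverts (corona G complete_1). h p) = (\<Sum>y\<in>pverts G. \<Sum>q\<in>{None, Some ()}. h (y, q))"
    unfolding pverts_corona_complete_1 using assms by (subst sum.cartesian_product) simp
  also have "\<dots> = (\<Sum>y\<in>pverts G. h (y, None)) + (\<Sum>y\<in>pverts G. h (y, Some ()))"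
    by (simp add: sum.distrib)
  finally show ?thesis .
qed

lemma adjacency_corona_complete_1:
  assumes "x \<in> pverts G" "y \<in> pverts G"
  shows "adjacency_matrix (corona G complete_1) (x, None) (y, None) = adjacency_matrix G x y"
    and "adjacency_matrix (corona G complete_1) (x, None) (y, Some ()) = (if x = y then 1 else 0)"
    and "adjacency_matrix (corona G complete_1) (x, Some ()) (y, None) = (if x = y then 1 else 0)"
    and "adjacency_matrix (corona G complete_1) (x, Some ()) (y, Some ()) = 0"
  using assms by (auto simp: adjacency_matrix_def corona_def Let_def complete_1_def)

lemma basis_vector_lift:
  "basis_vector (u, None) (x, None) = basis_vector u x"
  "basis_vector (u, None) (x, Some y) = 0"
  by (simp_all add: basis_vector_def)

text \<open>
  An eigenvector \<open>f\<close> of \<open>G\<close> with eigenvalue \<open>\<nu>\<close> lifts to \<open>(\<mu> * f, f)\<close>, for each root \<open>\<mu>\<close> of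
  \<open>\<mu>\<^sup>2 = \<nu> * \<mu> + 1\<close>.
\<close>

lemma eigenvector_corona_complete_1:
  assumes V: "finite (pverts G)" and f: "eigenvector G f \<nu>" and \<mu>: "\<mu> * \<mu> = \<nu> * \<mu> + 1"
  shows "eigenvector (corona G complete_1)
    (\<lambda>(x, q). k * (if q = None then \<mu> else 1) * f x) \<mu>"
  unfolding eigenvector_def sum_corona_complete_1[OF V]
proof
  fix p assume "p \<in> pverts (corona G complete_1)"
  then obtain x where x: "x \<in> pverts G" and p: "p = (x, None) \<or> p = (x, Some ())"
    by (auto simp: pverts_corona_complete_1)
  have delta: "(\<Sum>y\<in>pverts G. (if x = y then 1 else 0) * h y) = h x" for h :: "_ \<Rightarrow> complex"
  proof -
    have "(\<Sum>y\<in>pverts G. (if x = y then 1 else 0) * h y) = (\<Sum>y\<in>pverts G. if x = y then h y else 0)"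
      by (intro sum.cong) auto
    then show ?thesis using V x by simp
  qed
  have A: "(\<Sum>y\<in>pverts G. adjacency_matrix G x y * (k * \<mu> * f y)) = k * \<mu> * (\<nu> * f x)"
    using f x unfolding eigenvector_def by (simp add: mult.left_commute flip: sum_distrib_left)
  have B: "k * \<mu> * (\<nu> * f x) + k * f x = \<mu> * (k * \<mu> * f x)"
  proof -
    have "\<mu> * (k * \<mu> * f x) = k * (\<mu> * \<mu>) * f x" by simp
    then show ?thesis unfolding \<mu> by (simp add: algebra_simps)
  qed
  from p show "(\<Sum>y\<in>pverts G. adjacency_matrix (corona G complete_1) p (y, None) *
        (case (y, None) of (x, q) \<Rightarrow> k * (if q = None then \<mu> else 1) * f x)) +
      (\<Sum>y\<in>pverts G. adjacency_matrix (corona G complete_1) p (y, Some ()) *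
        (case (y, Some ()) of (x, q) \<Rightarrow> k * (if q = None then \<mu> else 1) * f x)) =
      \<mu> * (case p of (x, q) \<Rightarrow> k * (if q = None then \<mu> else 1) * f x)"
    using x A B delta[of "\<lambda>y. k * f y"] delta[of "\<lambda>y. k * \<mu> * f y"]
    by (elim disjE) (simp_all add: adjacency_corona_complete_1)
qed

text \<open>
  The hypothesis on the phases says that \<open>G\<close> itself has perfect state transfer at time \<open>\<pi> / 2\<close>. In
  the corona, at time \<open>\<pi> * (4 * l + 1)\<close>, the phases of the two lifts of \<open>f i\<close> are
  \<open>exp (- \<i> * \<pi> * ev i / 2)\<close> times \<open>exp\<close> of \<open>\<plusminus> \<i> * \<pi> * (4 * l + 1) * \<Delta> i / 2\<close>, where
  \<open>\<Delta> i = sqrt ((ev i)\<^sup>2 + 4)\<close>. The first factor is the phase of perfect state transfer in \<open>G\<close>,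
  and the second one is close to a sign that depends neither on \<open>i\<close> nor on the lift.
\<close>

theorem pretty_good_state_transfer_corona:
  fixes ev :: "'i \<Rightarrow> int"
  assumes V: "finite (pverts G)" and I: "finite I"
    and f: "\<And>i. i \<in> I \<Longrightarrow> eigenvector G (f i) (of_int (ev i))"
    and u: "\<And>x. x \<in> pverts G \<Longrightarrow> basis_vector u x = (\<Sum>i\<in>I. f i x)"
    and v: "\<And>x. x \<in> pverts G \<Longrightarrow> basis_vector v x = (\<Sum>i\<in>I. s i * f i x)"
    and parity: "(\<forall>i\<in>I. even (ev i)) \<or> (\<forall>i\<in>I. odd (ev i))"
    and \<gamma>: "norm \<gamma> = 1" and phase: "\<And>i. i \<in> I \<Longrightarrow> cis (- (pi / 2) * of_int (ev i)) = \<gamma> * s i"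
  shows "pretty_good_state_transfer (corona G complete_1) (u, None) (v, None)"
proof -
  define \<Delta> where "\<Delta> i = sqrt (of_int ((ev i)\<^sup>2 + 4))" for i
  have \<Delta>2: "\<Delta> i * \<Delta> i = of_int (ev i) * of_int (ev i) + 4" for i
    by (simp add: \<Delta>_def power2_eq_square)
  have \<Delta>: "\<Delta> i \<noteq> 0" for i
  proof
    assume "\<Delta> i = 0"
    then have "of_int (ev i) * of_int (ev i) + 4 = (0 :: real)" using \<Delta>2[of i] by simp
    moreover have "of_int (ev i) * of_int (ev i) \<ge> (0 :: real)" by simp
    ultimately show False by linarith
  qed
  define sg where "sg b = (if b then 1 else - 1 :: real)" for b
  define \<mu> where "\<mu> = (\<lambda>(i, b). (of_int (ev i) + sg b * \<Delta> i) / 2)"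
  define w where "w = (\<lambda>(i, b) (x, q :: unit option).
    of_real (sg b / \<Delta> i) * (if q = None then of_real (\<mu> (i, b)) else 1) * f i x)"
  \<comment> \<open>\<open>w (i, True)\<close> and \<open>w (i, False)\<close> are multiples of the two lifts of \<open>f i\<close>, with sum \<open>(f i, 0)\<close>.\<close>
  let ?J = "I \<times> {True, False}"
  have sum_J: "(\<Sum>j\<in>?J. h j) = (\<Sum>i\<in>I. h (i, True) + h (i, False))" for h :: "_ \<Rightarrow> complex"
  proof -
    have "(\<Sum>j\<in>?J. h j) = (\<Sum>i\<in>I. \<Sum>b\<in>{True, False}. h (i, b))"
      using I by (subst sum.cartesian_product) simp
    then show ?thesis by simp
  qed
  have w_None: "w (i, True) (x, None) + w (i, False) (x, None) = f i x" for i x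
  proof -
    have "w (i, True) (x, None) + w (i, False) (x, None)
        = of_real ((\<mu> (i, True) - \<mu> (i, False)) / \<Delta> i) * f i x"
      by (simp add: w_def sg_def algebra_simps diff_divide_distrib)
    also have "(\<mu> (i, True) - \<mu> (i, False)) / \<Delta> i = 1"
      using \<Delta>[of i] by (simp add: \<mu>_def sg_def field_simps)
    finally show ?thesis by simp
  qed
  have w_Some: "w (i, True) (x, Some ()) + w (i, False) (x, Some ()) = 0" for i x
    by (simp add: w_def sg_def)
  show ?thesis
  proof (rule pretty_good_state_transferI[where I = ?J and w = w and \<theta> = \<mu> and s = "s \<circ> fst"])
    show "finite (pverts (corona G complete_1))"
      using V by (simp add: pverts_corona_complete_1)
    show "finite ?J" using I by simp
    show "eigenvector (corona G complete_1) (w j) (of_real (\<mu> j))" if "j \<in> ?J" for j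
    proof -
      obtain i b where j: "j = (i, b)" "i \<in> I" using \<open>j \<in> ?J\<close> by auto
      have "\<mu> j * \<mu> j = of_int (ev i) * \<mu> j + 1"
        using \<Delta>2[of i] by (simp add: \<mu>_def j sg_def field_simps)
      then have "complex_of_real (\<mu> j) * of_real (\<mu> j) = of_int (ev i) * of_real (\<mu> j) + 1"
        by (metis of_real_mult of_real_add of_real_1 of_real_of_int_eq)
      from eigenvector_corona_complete_1[OF V f[OF j(2)] this, of "of_real (sg b / \<Delta> i)"]
      show ?thesis unfolding j(1) w_def by simp
    qed
    show "basis_vector (u, None) p = (\<Sum>j\<in>?J. w j p)" if "p \<in> pverts (corona G complete_1)" for p
    proof -
      obtain x where "x \<in> pverts G" and "p = (x, None) \<or> p = (x, Some ())"
        using \<open>p \<in> _\<close> by (auto simp: pverts_corona_complete_1)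
      then show ?thesis
        by (elim disjE) (simp_all add: sum_J w_None w_Some basis_vector_lift flip: u)
    qed
    show "basis_vector (v, None) p = (\<Sum>j\<in>?J. (s \<circ> fst) j * w j p)"
      if "p \<in> pverts (corona G complete_1)" for p
    proof -
      obtain x where "x \<in> pverts G" and "p = (x, None) \<or> p = (x, Some ())"
        using \<open>p \<in> _\<close> by (auto simp: pverts_corona_complete_1)
      then show ?thesis
        by (elim disjE)
          (simp_all add: sum_J w_None w_Some basis_vector_lift flip: v distrib_left)
    qed
    show "\<exists>\<tau> \<gamma>'. norm \<gamma>' = 1 \<and> (\<forall>j\<in>?J. norm (cis (- \<tau> * \<mu> j) - \<gamma>' * (s \<circ> fst) j) < \<delta>)"
      if \<delta>: "\<delta> > 0" for \<delta> :: real
    proof -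
      obtain l :: int and \<kappa> :: complex where \<kappa>: "\<kappa> = 1 \<or> \<kappa> = - 1"
        and l: "\<forall>\<nu>\<in>ev ` I. norm (cis (pi * of_int (4 * l + 1) * sqrt (of_int (\<nu>\<^sup>2 + 4)) / 2) - \<kappa>) < \<delta>"
        by (rule simultaneous_phases[of "ev ` I" \<delta>]) (use I parity \<delta> in auto)
      define \<tau> where "\<tau> = pi * of_int (4 * l + 1)"
      have "norm (cis (- \<tau> * \<mu> (i, b)) - (\<gamma> * \<kappa>) * s i) < \<delta>" if i: "i \<in> I" for i b
      proof -
        have "- \<tau> * \<mu> (i, b) = - (pi / 2) * of_int (ev i) + 2 * pi * of_int (- l * ev i)
            + - sg b * (\<tau> * \<Delta> i / 2)"
          by (simp add: \<mu>_def \<tau>_def algebra_simps add_divide_distrib)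
        then have "cis (- \<tau> * \<mu> (i, b)) = \<gamma> * s i * cis (- sg b * (\<tau> * \<Delta> i / 2))"
          by (simp only: cis_mult[symmetric] cis_multiple_2pi[OF Ints_of_int] phase[OF i]) simp
        then have "norm (cis (- \<tau> * \<mu> (i, b)) - (\<gamma> * \<kappa>) * s i)
            = norm (\<gamma> * s i) * norm (cis (- sg b * (\<tau> * \<Delta> i / 2)) - \<kappa>)"
          by (simp add: algebra_simps flip: norm_mult)
        also have "norm (\<gamma> * s i) = 1" by (simp flip: phase[OF i])
        also have "norm (cis (- sg b * (\<tau> * \<Delta> i / 2)) - \<kappa>) = norm (cis (\<tau> * \<Delta> i / 2) - \<kappa>)"
        proof (cases b)
          case True
          have "cis (- (\<tau> * \<Delta> i / 2)) - \<kappa> = cnj (cis (\<tau> * \<Delta> i / 2) - \<kappa>)"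
            using \<kappa> by (auto simp: cis_cnj)
          then have "norm (cis (- (\<tau> * \<Delta> i / 2)) - \<kappa>) = norm (cis (\<tau> * \<Delta> i / 2) - \<kappa>)"
            by (simp only: complex_mod_cnj)
          then show ?thesis using True by (simp add: sg_def)
        qed (simp add: sg_def)
        also have "\<dots> < \<delta>" using l i by (simp add: \<tau>_def \<Delta>_def)
        finally show ?thesis by simp
      qed
      moreover have "norm (\<gamma> * \<kappa>) = 1" using \<gamma> \<kappa> by (auto simp: norm_mult)
      ultimately show ?thesis by (intro exI[of _ \<tau>] exI[of _ "\<gamma> * \<kappa>"]) auto
    qed
  qed
qed

section \<open>Bounds for distances\<close>

lemma fin_digraph_with_proj: "pair_graph G \<Longrightarrow> fin_digraph (with_proj G)"
proof -
  assume "pair_graph G"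
  then interpret pair_graph G .
  show ?thesis by (rule fin_digraph_axioms)
qed

lemma graph_dist_refl_le:
  assumes "pair_graph G" "u \<in> pverts G"
  shows "graph_dist G u u \<le> 0"
proof -
  interpret W: fin_digraph "with_proj G" by (rule fin_digraph_with_proj) fact
  have "W.awalk u [] u" using assms(2) by (simp add: W.awalk_Nil_iff)
  from W.min_cost_le_walk_cost[OF this, of "\<lambda>_. 1"] show ?thesis
    by (simp add: graph_dist_def zero_ereal_def)
qed

lemma graph_dist_step:
  assumes "pair_graph G" "(x, y) \<in> parcs G" "graph_dist G u x \<le> ereal r"
  shows "graph_dist G u y \<le> ereal (r + 1)"
proof -
  interpret W: fin_digraph "with_proj G" by (rule fin_digraph_with_proj) fact
  have "W.\<mu> (\<lambda>_. 1) u y \<le> W.\<mu> (\<lambda>_. 1) u x + ereal 1"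
    by (rule W.pos_cost_mu_triangle[where e = "(x, y)"])
      (use assms(2) in \<open>auto simp: arc_to_ends_def\<close>)
  also have "\<dots> \<le> ereal r + ereal 1"
    using assms(3) unfolding graph_dist_def by (rule add_right_mono)
  finally show ?thesis by (simp add: graph_dist_def)
qed

text \<open>A function that grows by at most \<open>c\<close> along each arc bounds the distance from below.\<close>

lemma graph_dist_ge:
  fixes h :: "'a \<Rightarrow> nat"
  assumes "pair_graph G" and h: "\<And>x y. (x, y) \<in> parcs G \<Longrightarrow> h y \<le> h x + c"
    and "h u = 0" "c * k \<le> h v" "c > 0"
  shows "ereal (real k) \<le> graph_dist G u v"
proof -
  interpret W: fin_digraph "with_proj G" by (rule fin_digraph_with_proj) fact
  have walk: "h v \<le> h u + c * length p" if "W.awalk u p v" for u p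
    using that
  proof (induction p arbitrary: u)
    case (Cons e p)
    then have e: "e \<in> parcs G" "fst e = u" and "W.awalk (snd e) p v"
      by (auto simp: W.awalk_Cons_iff)
    moreover from e have "(u, snd e) \<in> parcs G" by auto
    ultimately show ?case using Cons.IH[of "snd e"] h[of u "snd e"] by simp
  qed (simp add: W.awalk_Nil_iff)
  have "ereal (real k) \<le> ereal (W.awalk_cost (\<lambda>_. 1) p)" if "W.awalk u p v" for p
  proof -
    have "c * k \<le> c * length p" using walk[OF that] assms(3,4) by linarith
    then have "k \<le> length p" using \<open>c > 0\<close> by simp
    moreover have "W.awalk_cost (\<lambda>_. 1) p = real (length p)"
      by (induction p) simp_all
    ultimately show ?thesis by simp
  qed
  then show ?thesis
    unfolding graph_dist_def W.\<mu>_def by (intro INF_greatest) simp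
qed

lemma antipodal_dist_ge:
  assumes "antipodal G u v" "u \<in> pverts G" "w \<in> pverts G"
  shows "graph_dist G u w \<le> graph_dist G u v"
proof -
  have "graph_dist G u w \<le> graph_diameter G"
    unfolding graph_diameter_def
    by (rule SUP_upper2[of "(u, w)"]) (use assms in auto)
  then show ?thesis using assms(1) by (simp add: antipodal_def)
qed

section \<open>Binary words and their characters\<close>

text \<open>The word \<open>x\<close> with the letters at the positions in \<open>T\<close> changed.\<close>

definition flip :: "nat set \<Rightarrow> bool list \<Rightarrow> bool list" where
  "flip T x = map (\<lambda>i. x ! i \<noteq> (i \<in> T)) [0..<length x]"

text \<open>The positions at which two words of equal length differ.\<close>

definition diff_set :: "bool list \<Rightarrow> bool list \<Rightarrow> nat set" where
  "diff_set x y = {i. i < length x \<and> x ! i \<noteq> y ! i}"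

lemma length_flip [simp]: "length (flip T x) = length x"
  by (simp add: flip_def)

lemma nth_flip [simp]: "i < length x \<Longrightarrow> flip T x ! i = (x ! i \<noteq> (i \<in> T))"
  by (simp add: flip_def)

lemma flip_empty [simp]: "flip {} x = x"
  by (simp add: list_eq_iff_nth_eq)

lemma flip_diff_set: "length y = length x \<Longrightarrow> flip (diff_set x y) x = y"
  by (auto simp: list_eq_iff_nth_eq diff_set_def)

lemma diff_set_flip: "T \<subseteq> {..<length x} \<Longrightarrow> diff_set x (flip T x) = T"
  by (auto simp: diff_set_def)

lemma diff_set_subset: "diff_set x y \<subseteq> {..<length x}"
  by (auto simp: diff_set_def)

lemma finite_diff_set [simp]: "finite (diff_set x y)"
  using diff_set_subset finite_subset by blast

lemma hamming_dist_eq_card: "hamming_dist x y = card (diff_set x y)"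
  by (simp add: hamming_dist_def diff_set_def)

lemma hamming_dist_flip_flip:
  assumes "A \<subseteq> B" "B \<subseteq> {..<length x}"
  shows "hamming_dist (flip A x) (flip B x) = card (B - A)"
proof -
  have "diff_set (flip A x) (flip B x) = B - A"
    using assms by (auto simp: diff_set_def)
  then show ?thesis by (simp add: hamming_dist_eq_card)
qed

lemma hamming_dist_triangle:
  assumes "length u = length x"
  shows "hamming_dist u y \<le> hamming_dist u x + hamming_dist x y"
proof -
  have "diff_set u y \<subseteq> diff_set u x \<union> diff_set x y"
    using assms by (auto simp: diff_set_def)
  then have "card (diff_set u y) \<le> card (diff_set u x \<union> diff_set x y)"
    by (intro card_mono) auto
  also have "\<dots> \<le> card (diff_set u x) + card (diff_set x y)"
    by (rule card_Un_le)
  finally show ?thesis by (simp add: hamming_dist_eq_card)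
qed

text \<open>The character of the group of binary words that belongs to the set \<open>S\<close> of positions.\<close>

definition character :: "nat set \<Rightarrow> bool list \<Rightarrow> complex" where
  "character S x = (\<Prod>i\<in>S. if x ! i then - 1 else 1)"

lemma prod_signs:
  assumes "finite A"
  shows "(\<Prod>i\<in>A. if i \<in> B then - 1 else (1 :: complex)) = (- 1) ^ card (A \<inter> B)"
  using prod.inter_restrict[OF assms, of "\<lambda>_. - 1 :: complex" B] by simp

lemma character_flip:
  assumes "S \<subseteq> {..<length x}" "T \<subseteq> {..<length x}"
  shows "character S (flip T x) = character S x * (\<Prod>i\<in>T. if i \<in> S then - 1 else 1)"
proof -
  have fin: "finite S" "finite T" using assms finite_subset by blast+
  have "character S (flip T x)
      = (\<Prod>i\<in>S. (if x ! i then - 1 else 1) * (if i \<in> T then - 1 else 1))"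
    unfolding character_def using assms by (intro prod.cong) auto
  also have "\<dots> = character S x * (\<Prod>i\<in>T. if i \<in> S then - 1 else 1)"
    using fin by (simp add: prod.distrib character_def prod_signs Int_commute)
  finally show ?thesis .
qed

lemma character_flip_all:
  assumes "S \<subseteq> {..<length x}"
  shows "character S (flip {..<length x} x) = (- 1) ^ card S * character S x"
proof -
  have "(\<Prod>i<length x. if i \<in> S then - 1 else (1 :: complex)) = (- 1) ^ card ({..<length x} \<inter> S)"
    by (simp add: prod_signs)
  also have "{..<length x} \<inter> S = S" using assms by blast
  finally show ?thesis using assms by (simp add: character_flip)
qed

lemma sum_characters:
  assumes "length x = m" "length u = m"
  shows "(\<Sum>S\<in>Pow {..<m}. character S u * character S x) = 2 ^ m * basis_vector u x"
proof -
  let ?e = "\<lambda>i. (if u ! i then - 1 else 1) * (if x ! i then - 1 else 1) :: complex"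
  have "(\<Sum>S\<in>Pow {..<m}. character S u * character S x)
      = (\<Sum>S\<in>Pow {..<m}. (\<Prod>i\<in>S. ?e i) * (\<Prod>i\<in>{..<m} - S. 1))"
    by (simp add: character_def prod.distrib)
  also have "\<dots> = (\<Prod>i<m. ?e i + 1)"
    by (rule prod_add[symmetric]) simp
  also have "\<dots> = 2 ^ m * basis_vector u x"
  proof (cases "x = u")
    case True
    have "(\<Prod>i<m. ?e i + 1) = (\<Prod>i<m. 2)" by (intro prod.cong) (auto simp: True)
    then show ?thesis by (simp add: True basis_vector_def)
  next
    case False
    then obtain i where "i < m" "x ! i \<noteq> u ! i"
      using assms by (auto simp: list_eq_iff_nth_eq)
    then have "(\<Prod>i<m. ?e i + 1) = 0"
      by (intro prod_zero) (auto intro!: bexI[of _ i])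
    then show ?thesis using False by (simp add: basis_vector_def)
  qed
  finally show ?thesis .
qed

text \<open>The parity of the weight is the character of the set of all positions.\<close>

lemma even_weight_flip:
  assumes "T \<subseteq> {..<length x}"
  shows "even (weight (flip T x)) \<longleftrightarrow> even (weight x + card T)"
proof -
  have ch: "character {..<length y} y = (- 1) ^ weight y" for y
  proof -
    have "character {..<length y} y = (- 1) ^ card ({..<length y} \<inter> {i. y ! i})"
      using prod_signs[of "{..<length y}" "{i. y ! i}"] by (simp add: character_def)
    also have "{..<length y} \<inter> {i. y ! i} = {i. i < length y \<and> y ! i}" by auto
    finally show ?thesis by (simp add: weight_def)
  qed
  have "(\<Prod>i\<in>T. if i < length x then - 1 else (1 :: complex)) = (- 1) ^ card T"
    using assms by (subst prod.cong[of T T _ "\<lambda>_. - 1"]) auto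
  then have "(- 1 :: complex) ^ weight (flip T x) = (- 1) ^ (weight x + card T)"
    using character_flip[of "{..<length x}" x T] ch[of x] ch[of "flip T x"] assms
    by (simp add: power_add)
  then show ?thesis
    by (metis neg_one_even_power neg_one_odd_power one_neq_neg_one)
qed

text \<open>
  The next lemmas evaluate the elementary symmetric sums of degree at most two. When
  \<open>e i\<close> is \<open>- 1\<close> for \<open>i \<in> S\<close> and \<open>1\<close> otherwise, they are the eigenvalues that belong to \<open>character S\<close>
  for the relations of differing in exactly one or in exactly two positions.
\<close>

lemma sum_subsets_card_insert:
  fixes e :: "'a \<Rightarrow> complex"
  assumes "finite F" "a \<notin> F"
  shows "(\<Sum>T | T \<subseteq> insert a F \<and> card T = Suc k. prod e T)
    = (\<Sum>T | T \<subseteq> F \<and> card T = Suc k. prod e T) + e a * (\<Sum>T | T \<subseteq> F \<and> card T = k. prod e T)"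
proof -
  let ?A = "{T. T \<subseteq> F \<and> card T = Suc k}" and ?B = "{T. T \<subseteq> F \<and> card T = k}"
  have fin: "finite ?A" "finite ?B"
    using assms by (auto intro: finite_subset[of _ "Pow F"])
  have ins: "card (insert a T) = Suc (card T)" if "T \<subseteq> F" for T
    using that assms finite_subset[of T F] by (subst card_insert_disjoint) auto
  have "{T. T \<subseteq> insert a F \<and> card T = Suc k} = ?A \<union> insert a ` ?B"
  proof (intro equalityI subsetI)
    fix T assume T: "T \<in> {T. T \<subseteq> insert a F \<and> card T = Suc k}"
    show "T \<in> ?A \<union> insert a ` ?B"
    proof (cases "a \<in> T")
      case True
      then have "T = insert a (T - {a})" "T - {a} \<subseteq> F" using T by auto
      moreover from this have "card (T - {a}) = k" using ins[of "T - {a}"] T by auto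
      ultimately show ?thesis by blast
    qed (use T in auto)
  qed (auto simp: ins)
  moreover have "?A \<inter> insert a ` ?B = {}" using assms by auto
  ultimately have "(\<Sum>T | T \<subseteq> insert a F \<and> card T = Suc k. prod e T)
      = sum (prod e) ?A + sum (prod e) (insert a ` ?B)"
    using fin by (simp add: sum.union_disjoint)
  also have "sum (prod e) (insert a ` ?B) = (\<Sum>T\<in>?B. prod e (insert a T))"
    using assms by (subst sum.reindex) (auto simp: inj_on_def)
  also have "\<dots> = (\<Sum>T\<in>?B. e a * prod e T)"
    using assms finite_subset[of _ F] by (intro sum.cong) (auto intro!: prod.insert)
  finally show ?thesis by (simp add: sum_distrib_left)
qed

lemma sum_subsets_card_0:
  "finite F \<Longrightarrow> (\<Sum>T | T \<subseteq> F \<and> card T = 0. prod e T) = (1 :: complex)"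
proof -
  assume "finite F"
  then have "{T. T \<subseteq> F \<and> card T = 0} = {{}}" by (auto dest: finite_subset)
  then show ?thesis by simp
qed

lemma sum_subsets_card_1:
  fixes e :: "'a \<Rightarrow> complex"
  assumes "finite F"
  shows "(\<Sum>T | T \<subseteq> F \<and> card T = 1. prod e T) = sum e F"
  using assms
proof (induction F)
  case (insert a F)
  then show ?case
    using sum_subsets_card_insert[of F a e 0] sum_subsets_card_0[of F e] by simp
qed (simp add: card_eq_0_iff conj_commute)

lemma sum_subsets_card_2:
  fixes e :: "'a \<Rightarrow> complex"
  assumes "finite F"
  shows "2 * (\<Sum>T | T \<subseteq> F \<and> card T = 2. prod e T) = (sum e F)\<^sup>2 - (\<Sum>i\<in>F. (e i)\<^sup>2)"
  using assms
proof (induction F)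
  case (insert a F)
  then show ?case
    using sum_subsets_card_insert[of F a e 1] sum_subsets_card_1[of F e]
    by (simp add: numeral_2_eq_2 distrib_left) (simp add: power2_eq_square algebra_simps)
qed (simp add: conj_commute)

lemma sum_hamming_sphere:
  fixes h :: "bool list \<Rightarrow> complex"
  assumes "length x = m"
  shows "(\<Sum>y | length y = m \<and> hamming_dist x y = k. h y)
    = (\<Sum>T | T \<subseteq> {..<m} \<and> card T = k. h (flip T x))"
  by (rule sum.reindex_bij_witness[where i = "\<lambda>T. flip T x" and j = "diff_set x"])
    (use assms diff_set_subset[of x] in
      \<open>auto simp: flip_diff_set diff_set_flip hamming_dist_eq_card\<close>)

lemma sum_signs:
  assumes "S \<subseteq> {..<m}"
  shows "(\<Sum>i<m. if i \<in> S then - 1 else (1 :: complex)) = of_int (int m - 2 * int (card S))"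
proof -
  have "finite S" using assms finite_subset by blast
  have "(\<Sum>i<m. if i \<in> S then - 1 else (1 :: complex))
      = (\<Sum>i<m. 1 - 2 * (if i \<in> S then 1 else 0))"
    by (intro sum.cong) auto
  also have "\<dots> = of_nat m - 2 * (\<Sum>i<m. if i \<in> S then 1 else 0)"
    by (simp add: sum_subtractf sum_distrib_left)
  also have "(\<Sum>i<m. if i \<in> S then 1 else (0 :: complex)) = of_nat (card ({..<m} \<inter> S))"
    by (simp add: sum.If_cases)
  also have "{..<m} \<inter> S = S" using assms by blast
  finally show ?thesis by simp
qed

section \<open>Hypercubes\<close>

lemma eigenvector_hypercube:
  assumes "S \<subseteq> {..<d}"
  shows "eigenvector (hypercube d) (\<lambda>x. k * character S x) (of_int (int d - 2 * int (card S)))"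
  unfolding eigenvector_def
proof
  fix x assume "x \<in> pverts (hypercube d)"
  then have x: "length x = d" by (simp add: hypercube_def)
  have "(\<Sum>y\<in>pverts (hypercube d). adjacency_matrix (hypercube d) x y * (k * character S y))
      = (\<Sum>y | length y = d \<and> hamming_dist x y = 1. k * character S y)"
    using x finite_words[of d "\<lambda>_. True"]
    by (intro sum.mono_neutral_cong_right) (auto simp: hypercube_def adjacency_matrix_def)
  also have "\<dots> = (\<Sum>T | T \<subseteq> {..<d} \<and> card T = 1. k * character S (flip T x))"
    by (rule sum_hamming_sphere[OF x])
  also have "\<dots> = (\<Sum>T | T \<subseteq> {..<d} \<and> card T = 1.
      k * character S x * (\<Prod>i\<in>T. if i \<in> S then - 1 else 1))"
    using assms x by (intro sum.cong) (auto simp: character_flip)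
  also have "\<dots> = k * character S x * (\<Sum>i<d. if i \<in> S then - 1 else 1)"
    using sum_subsets_card_1[of "{..<d}" "\<lambda>i. if i \<in> S then - 1 else 1"]
    by (simp flip: sum_distrib_left)
  finally show "(\<Sum>y\<in>pverts (hypercube d). adjacency_matrix (hypercube d) x y * (k * character S y))
      = of_int (int d - 2 * int (card S)) * (k * character S x)"
    using assms by (simp add: sum_signs)
qed

lemma antipodal_hypercube:
  assumes "antipodal (hypercube d) u v"
  shows "v = flip {..<d} u"
proof -
  let ?G = "hypercube d"
  note G = pair_graph_hypercube[of d]
  have u: "length u = d" and v: "length v = d"
    using assms by (auto simp: antipodal_def hypercube_def)
  have V: "x \<in> pverts ?G \<longleftrightarrow> length x = d" for x by (simp add: hypercube_def)
  have upper: "graph_dist ?G u (flip T u) \<le> ereal (real (card T))" if "T \<subseteq> {..<d}" for T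
  proof -
    have "finite T" using that finite_subset by blast
    then show ?thesis using that
    proof (induction T)
      case empty
      then show ?case using graph_dist_refl_le[OF G] u by (simp add: V zero_ereal_def)
    next
      case (insert a T)
      have "insert a T - T = {a}" using insert by auto
      then have "hamming_dist (flip T u) (flip (insert a T) u) = 1"
        using hamming_dist_flip_flip[of T "insert a T" u] insert u by auto
      then have "(flip T u, flip (insert a T) u) \<in> parcs ?G"
        using u by (simp add: hypercube_def)
      from graph_dist_step[OF G this, of u "card T"] show ?case
        using insert by (simp add: add.commute)
    qed
  qed
  have "ereal (real d) \<le> graph_dist ?G u (flip {..<d} u)"
  proof (rule graph_dist_ge[OF G, where h = "hamming_dist u" and c = 1])
    show "hamming_dist u y \<le> hamming_dist u x + 1" if "(x, y) \<in> parcs ?G" for x y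
      using hamming_dist_triangle[of u x y] that u by (simp add: hypercube_def)
  qed (use u in \<open>simp_all add: hamming_dist_eq_card diff_set_flip, simp add: diff_set_def\<close>)
  also have "\<dots> \<le> graph_dist ?G u v"
    by (rule antipodal_dist_ge[OF assms]) (simp_all add: V u)
  also have "\<dots> \<le> ereal (real (card (diff_set u v)))"
    using upper[of "diff_set u v"] diff_set_subset[of u v] u v by (simp add: flip_diff_set)
  finally have "card {..<d} \<le> card (diff_set u v)" by simp
  then have "diff_set u v = {..<d}"
    using diff_set_subset[of u v] u by (intro card_seteq) auto
  then show ?thesis using flip_diff_set[of v u] u v by simp
qed

text \<open>
  The component of the word \<open>u\<close> along \<open>character S\<close> differs from that of the complementary word by
  the sign \<open>(- 1) ^ card S\<close>. The vertex set may be a proper subset of the words of length \<open>m\<close>: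
  the expansion in characters stays valid by restriction, although the characters need not
  remain linearly independent.
\<close>

lemma pretty_good_state_transfer_corona_characters:
  fixes ev :: "nat set \<Rightarrow> int"
  assumes V: "pverts G \<subseteq> {x. length x = m}" and u: "length u = m"
    and eig: "\<And>S k. S \<subseteq> {..<m} \<Longrightarrow> eigenvector G (\<lambda>x. k * character S x) (of_int (ev S))"
    and parity: "\<And>S. S \<subseteq> {..<m} \<Longrightarrow> even (ev S) = even (ev {})"
    and \<gamma>: "norm \<gamma> = 1"
    and phase: "\<And>S. S \<subseteq> {..<m} \<Longrightarrow> cis (- (pi / 2) * of_int (ev S)) = \<gamma> * (- 1) ^ card S"
  shows "pretty_good_state_transfer (corona G complete_1) (u, None) (flip {..<m} u, None)"
proof (rule pretty_good_state_transfer_corona[where I = "Pow {..<m}" and ev = ev and \<gamma> = \<gamma>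
      and f = "\<lambda>S x. character S u / 2 ^ m * character S x" and s = "\<lambda>S. (- 1) ^ card S"])
  show "finite (pverts G)"
    using V finite_words[of m "\<lambda>_. True"] by (auto intro: finite_subset)
  show "basis_vector u x = (\<Sum>S\<in>Pow {..<m}. character S u / 2 ^ m * character S x)"
    if "x \<in> pverts G" for x
    using sum_characters[of x m u] that V u by (auto simp flip: sum_divide_distrib)
  show "basis_vector (flip {..<m} u) x
      = (\<Sum>S\<in>Pow {..<m}. (- 1) ^ card S * (character S u / 2 ^ m * character S x))"
    if "x \<in> pverts G" for x
  proof -
    have "(\<Sum>S\<in>Pow {..<m}. (- 1) ^ card S * (character S u / 2 ^ m * character S x))
        = (\<Sum>S\<in>Pow {..<m}. character S (flip {..<m} u) * character S x) / 2 ^ m"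
      unfolding sum_divide_distrib
    proof (rule sum.cong)
      fix S assume "S \<in> Pow {..<m}"
      then have "character S (flip {..<m} u) = (- 1) ^ card S * character S u"
        using character_flip_all[of S u] u by simp
      then show "(- 1) ^ card S * (character S u / 2 ^ m * character S x)
          = character S (flip {..<m} u) * character S x / 2 ^ m" by simp
    qed simp
    then show ?thesis
      using sum_characters[of x m "flip {..<m} u"] that V u by auto
  qed
  show "(\<forall>S\<in>Pow {..<m}. even (ev S)) \<or> (\<forall>S\<in>Pow {..<m}. odd (ev S))"
    using parity by blast
  show "eigenvector G (\<lambda>x. character S u / 2 ^ m * character S x) (of_int (ev S))"
    if "S \<in> Pow {..<m}" for S
    using that by (intro eig) auto
qed (use \<gamma> phase in auto)

lemma cis_nat_pi: "cis (real k * pi) = (- 1) ^ k"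
  by (metis Complex.DeMoivre cis_pi)

lemma hypercube_corona:
  assumes "antipodal (hypercube d) u v"
  shows "pretty_good_state_transfer (corona (hypercube d) complete_1) (u, None) (v, None)"
  unfolding antipodal_hypercube[OF assms]
proof (rule pretty_good_state_transfer_corona_characters[where
      ev = "\<lambda>S. int d - 2 * int (card S)" and \<gamma> = "cis (- (pi / 2) * real d)"])
  show "length u = d" using assms by (simp add: antipodal_def hypercube_def)
  show "cis (- (pi / 2) * of_int (int d - 2 * int (card S)))
      = cis (- (pi / 2) * real d) * (- 1) ^ card S" for S
  proof -
    have "- (pi / 2) * of_int (int d - 2 * int (card S)) = - (pi / 2) * real d + real (card S) * pi"
      by (simp add: algebra_simps)
    then show ?thesis
      by (simp only: cis_mult[symmetric] cis_nat_pi)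
  qed
  show "eigenvector (hypercube d) (\<lambda>x. k * character S x) (of_int (int d - 2 * int (card S)))"
    if "S \<subseteq> {..<d}" for S k
    using that by (rule eigenvector_hypercube)
qed (auto simp: hypercube_def)

section \<open>Halved cubes\<close>

lemma eigenvector_halved_cube:
  assumes S: "S \<subseteq> {..<2 * d}"
  shows "eigenvector (halved_cube (2 * d)) (\<lambda>x. k * character S x)
    (of_int (2 * (int d - int (card S))\<^sup>2 - int d))"
  unfolding eigenvector_def
proof
  let ?m = "2 * d"
  fix x assume "x \<in> pverts (halved_cube ?m)"
  then have x: "length x = ?m" "even (weight x)" by (auto simp: halved_cube_def)
  let ?e = "\<lambda>i. if i \<in> S then - 1 else (1 :: complex)"
  have even: "even (weight y)" if "length y = ?m" "hamming_dist x y = 2" for y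
    using that x even_weight_flip[OF diff_set_subset, of x y]
    by (simp add: flip_diff_set hamming_dist_eq_card)
  have "(\<Sum>y\<in>pverts (halved_cube ?m). adjacency_matrix (halved_cube ?m) x y * (k * character S y))
      = (\<Sum>y | length y = ?m \<and> hamming_dist x y = 2. k * character S y)"
    using x even finite_words[of ?m "\<lambda>x. even (weight x)"]
    by (intro sum.mono_neutral_cong_right) (auto simp: halved_cube_def adjacency_matrix_def)
  also have "\<dots> = (\<Sum>T | T \<subseteq> {..<?m} \<and> card T = 2. k * character S (flip T x))"
    by (rule sum_hamming_sphere[OF x(1)])
  also have "\<dots> = (\<Sum>T | T \<subseteq> {..<?m} \<and> card T = 2. k * character S x * prod ?e T)"
    using S x by (intro sum.cong) (auto simp: character_flip)
  also have "\<dots> = k * character S x * (\<Sum>T | T \<subseteq> {..<?m} \<and> card T = 2. prod ?e T)"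
    by (simp add: sum_distrib_left)
  also have "(\<Sum>T | T \<subseteq> {..<?m} \<and> card T = 2. prod ?e T)
      = of_int (2 * (int d - int (card S))\<^sup>2 - int d)"
  proof -
    have "(\<Sum>i<?m. (?e i)\<^sup>2) = (\<Sum>i<?m. 1)" by (intro sum.cong) auto
    then have "2 * (\<Sum>T | T \<subseteq> {..<?m} \<and> card T = 2. prod ?e T)
        = (of_int (int ?m - 2 * int (card S)))\<^sup>2 - of_nat ?m"
      using sum_subsets_card_2[of "{..<?m}" ?e] sum_signs[OF S] by simp
    also have "\<dots> = of_int ((int ?m - 2 * int (card S))\<^sup>2 - int ?m)" by simp
    also have "(int ?m - 2 * int (card S))\<^sup>2 - int ?m = 2 * (2 * (int d - int (card S))\<^sup>2 - int d)"
      by (simp add: power2_eq_square algebra_simps)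
    finally have "2 * (\<Sum>T | T \<subseteq> {..<?m} \<and> card T = 2. prod ?e T)
        = 2 * of_int (2 * (int d - int (card S))\<^sup>2 - int d)"
      by (simp only: of_int_mult of_int_numeral)
    then show ?thesis by (simp only: mult_cancel_left) simp
  qed
  finally show "(\<Sum>y\<in>pverts (halved_cube ?m).
        adjacency_matrix (halved_cube ?m) x y * (k * character S y))
      = of_int (2 * (int d - int (card S))\<^sup>2 - int d) * (k * character S x)"
    by simp
qed

lemma antipodal_halved_cube:
  assumes "antipodal (halved_cube (2 * d)) u v"
  shows "v = flip {..<2 * d} u"
proof -
  let ?G = "halved_cube (2 * d)"
  note G = pair_graph_halved_cube[of "2 * d"]
  have V: "x \<in> pverts ?G \<longleftrightarrow> length x = 2 * d \<and> even (weight x)" for x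
    by (simp add: halved_cube_def)
  have u: "length u = 2 * d" "even (weight u)" and v: "length v = 2 * d" "even (weight v)"
    using assms by (auto simp: antipodal_def halved_cube_def)
  have flip_V: "flip T u \<in> pverts ?G" if "T \<subseteq> {..<2 * d}" "even (card T)" for T
    using even_weight_flip[of T u] that u by (simp add: V)
  have upper: "graph_dist ?G u (flip T u) \<le> ereal (real k)"
    if "T \<subseteq> {..<2 * d}" "card T = 2 * k" for T k
    using that
  proof (induction k arbitrary: T)
    case 0
    then have "T = {}" using finite_subset[of T "{..<2 * d}"] by simp
    then show ?case using graph_dist_refl_le[OF G] u by (simp add: V zero_ereal_def)
  next
    case (Suc k)
    then obtain a A where a: "T = insert a A" "a \<notin> A" "card A = Suc (2 * k)"
      by (auto simp: card_Suc_eq)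
    then obtain b B where b: "A = insert b B" "b \<notin> B" "card B = 2 * k"
      by (auto simp: card_Suc_eq)
    have B: "B \<subseteq> {..<2 * d}" using Suc.prems a b by auto
    have "T - B = {a, b}" using a b by auto
    moreover have "a \<noteq> b" using a b by auto
    ultimately have "card (T - B) = 2" by simp
    then have "(flip B u, flip T u) \<in> parcs ?G"
      using flip_V[OF B] flip_V[of T] hamming_dist_flip_flip[of B T u] Suc.prems a b u
      by (auto simp: halved_cube_def)
    from graph_dist_step[OF G this, of u "real k"] show ?case
      using Suc.IH[OF B] b by (simp add: add.commute)
  qed
  have even: "even (card (diff_set u v))"
    using even_weight_flip[OF diff_set_subset, of u v] u v by (simp add: flip_diff_set)
  have "ereal (real d) \<le> graph_dist ?G u (flip {..<2 * d} u)"
  proof (rule graph_dist_ge[OF G, where h = "hamming_dist u" and c = 2])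
    show "hamming_dist u y \<le> hamming_dist u x + 2" if "(x, y) \<in> parcs ?G" for x y
      using hamming_dist_triangle[of u x y] that u by (simp add: halved_cube_def)
  qed (use u in \<open>simp_all add: hamming_dist_eq_card diff_set_flip, simp add: diff_set_def\<close>)
  also have "\<dots> \<le> graph_dist ?G u v"
    by (rule antipodal_dist_ge[OF assms]) (use flip_V[of "{..<2 * d}"] in \<open>simp_all add: V u\<close>)
  also have "\<dots> \<le> ereal (real (card (diff_set u v) div 2))"
    using upper[of "diff_set u v" "card (diff_set u v) div 2"] diff_set_subset[of u v] u v even
    by (simp add: flip_diff_set)
  \<comment> \<open>The number of differing positions is even, so no rounding occurs in the division by two.\<close>
  finally have "card {..<2 * d} \<le> card (diff_set u v)" by simp
  then have "diff_set u v = {..<2 * d}"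
    using diff_set_subset[of u v] u by (intro card_seteq) auto
  then show ?thesis using flip_diff_set[of v u] u v by simp
qed

lemma halved_cube_corona:
  assumes "antipodal (halved_cube (2 * d)) u v"
  shows "pretty_good_state_transfer (corona (halved_cube (2 * d)) complete_1) (u, None) (v, None)"
  unfolding antipodal_halved_cube[OF assms]
proof (rule pretty_good_state_transfer_corona_characters[where
      ev = "\<lambda>S. 2 * (int d - int (card S))\<^sup>2 - int d" and \<gamma> = "cis (pi / 2 * real d) * (- 1) ^ d"])
  show "length u = 2 * d" using assms by (simp add: antipodal_def halved_cube_def)
  show "norm (cis (pi / 2 * real d) * (- 1) ^ d) = 1" by (simp add: norm_mult norm_power)
  show "cis (- (pi / 2) * of_int (2 * (int d - int (card S))\<^sup>2 - int d))
      = cis (pi / 2 * real d) * (- 1) ^ d * (- 1) ^ card S" for S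
  proof -
    define j where "j = int d - int (card S)"
    \<comment> \<open>As \<open>j\<^sup>2\<close> and \<open>j\<close> have the same parity, \<open>cis (- pi * j\<^sup>2) = (- 1) ^ (d + card S)\<close>.\<close>
    have "even (j\<^sup>2 + int d + int (card S))" by (auto simp: j_def)
    then obtain q where q: "j\<^sup>2 + int d + int (card S) = 2 * q" by blast
    then have j2: "j\<^sup>2 = 2 * q - int d - int (card S)" by simp
    have "- (pi / 2) * of_int (2 * j\<^sup>2 - int d)
        = pi / 2 * real d + (real (d + card S) * pi + 2 * pi * of_int (- q))"
      unfolding j2 by (simp add: algebra_simps)
    then show ?thesis
      by (simp only: j_def[symmetric] cis_mult[symmetric] cis_multiple_2pi[OF Ints_of_int]
          cis_nat_pi) (simp add: power_add)
  qed
  show "eigenvector (halved_cube (2 * d)) (\<lambda>x. k * character S x)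
      (of_int (2 * (int d - int (card S))\<^sup>2 - int d))"
    if "S \<subseteq> {..<2 * d}" for S k
    using that by (rule eigenvector_halved_cube)
qed (auto simp: halved_cube_def)

section \<open>Cocktail party graphs\<close>

lemma pverts_cocktail_party: "pverts (cocktail_party n) = {..<n} \<times> UNIV"
  by (simp add: cocktail_party_def graph_complement_def disjoint_copies_def complete_2_def)

lemma parcs_cocktail_party:
  "((i, a), (j, b)) \<in> parcs (cocktail_party n) \<longleftrightarrow> i < n \<and> j < n \<and> i \<noteq> j"
  by (auto simp: cocktail_party_def graph_complement_def disjoint_copies_def complete_2_def)

lemma sum_neighbours_cocktail_party:
  assumes "i < n"
  shows "(\<Sum>y\<in>pverts (cocktail_party n). adjacency_matrix (cocktail_party n) (i, a) y * h y)
    = (\<Sum>y\<in>{..<n} \<times> UNIV. h y) - h (i, True) - h (i, False)"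
proof -
  have "(\<Sum>y\<in>pverts (cocktail_party n). adjacency_matrix (cocktail_party n) (i, a) y * h y)
      = (\<Sum>y\<in>{..<n} \<times> UNIV - {(i, True), (i, False)}. h y)"
  proof (rule sum.mono_neutral_cong_right)
    show "\<forall>y\<in>pverts (cocktail_party n) - ({..<n} \<times> UNIV - {(i, True), (i, False)}).
        adjacency_matrix (cocktail_party n) (i, a) y * h y = 0"
      by (auto simp: pverts_cocktail_party adjacency_matrix_def parcs_cocktail_party)
    show "adjacency_matrix (cocktail_party n) (i, a) y * h y = h y"
      if "y \<in> {..<n} \<times> UNIV - {(i, True), (i, False)}" for y
    proof -
      obtain j b where "y = (j, b)" by (cases y)
      then show ?thesis using that assms
        by (cases b) (auto simp: adjacency_matrix_def parcs_cocktail_party)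
    qed
  qed (auto simp: pverts_cocktail_party)
  also have "\<dots> = (\<Sum>y\<in>{..<n} \<times> UNIV. h y) - (\<Sum>y\<in>{(i, True), (i, False)}. h y)"
    using assms by (intro sum_diff) auto
  finally show ?thesis by simp
qed

lemma antipodal_cocktail_party:
  assumes "antipodal (cocktail_party n) (i, a) v"
  shows "v = (i, \<not> a)" "i < n"
proof -
  let ?G = "cocktail_party n"
  note G = pair_graph_cocktail_party[of n]
  obtain j b where v: "v = (j, b)" by (cases v)
  show i: "i < n" using assms by (simp add: antipodal_def pverts_cocktail_party)
  have j: "j < n" using assms by (simp add: antipodal_def pverts_cocktail_party v)
  have "ereal (real 2) \<le> graph_dist ?G (i, a) (i, \<not> a)"
    by (rule graph_dist_ge[OF G, where c = 1
          and h = "\<lambda>(j, b). if j \<noteq> i then 1 else if b = a then 0 else 2"])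
      (auto simp: parcs_cocktail_party split: if_splits)
  also have "\<dots> \<le> graph_dist ?G (i, a) v"
    by (rule antipodal_dist_ge[OF assms]) (simp_all add: i pverts_cocktail_party)
  finally have ge: "ereal 2 \<le> graph_dist ?G (i, a) v" by simp
  have refl: "graph_dist ?G (i, a) (i, a) \<le> ereal 0"
    using graph_dist_refl_le[OF G, of "(i, a)"] i by (simp add: pverts_cocktail_party zero_ereal_def)
  have "\<not> graph_dist ?G (i, a) v \<le> ereal 1"
  proof
    assume "graph_dist ?G (i, a) v \<le> ereal 1"
    with ge have "ereal 2 \<le> ereal 1" by (rule order_trans)
    then show False by simp
  qed
  moreover have "graph_dist ?G (i, a) v \<le> ereal 1" if "j \<noteq> i"
    using graph_dist_step[OF G _ refl, of v] that i j by (simp add: v parcs_cocktail_party)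
  moreover have "graph_dist ?G (i, a) v \<le> ereal 1" if "v = (i, a)"
    using refl that order_trans[of _ "ereal 0" "ereal 1"] by simp
  ultimately have "j = i" "v \<noteq> (i, a)" by blast+
  then show "v = (i, \<not> a)" using v by auto
qed

text \<open>
  The state at \<open>(i, a)\<close> is the sum of a constant vector (eigenvalue \<open>2 * n - 2\<close>), of half the
  difference of the states at \<open>(i, a)\<close> and \<open>(i, \<not> a)\<close> (eigenvalue \<open>0\<close>), and of a vector that is
  constant on the pairs of non-adjacent vertices and has sum zero (eigenvalue \<open>- 2\<close>).
\<close>

lemma cocktail_party_corona:
  assumes ap: "antipodal (cocktail_party n) (i, a) v" and "even n"
  shows "pretty_good_state_transfer (corona (cocktail_party n) complete_1) ((i, a), None) (v, None)"
  unfolding antipodal_cocktail_party(1)[OF ap]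
proof -
  have i: "i < n" by (rule antipodal_cocktail_party(2)[OF ap])
  define c :: complex where "c = 1 / (2 * of_nat n)"
  have c: "of_nat (n * 2) * c = 1" using i by (simp add: c_def)
  define g where "g r x = (if r = 1 then (if x = (i, a) then 1 / 2 else if x = (i, \<not> a) then - 1 / 2 else 0)
    else if r = 2 then (if fst x = i then 1 / 2 else 0) - c else c)" for r :: nat and x :: "nat \<times> bool"
  define ev where "ev r = (if r = 1 then 0 else if r = 2 then - 2 else 2 * int n - 2)" for r :: nat
  define s :: "nat \<Rightarrow> complex" where "s r = (if r = 1 then - 1 else 1)" for r
  have sum_bool: "(\<Sum>y\<in>{..<n} \<times> UNIV. h y) = (\<Sum>j<n. h (j, True) + h (j, False))"
    for h :: "nat \<times> bool \<Rightarrow> complex"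
  proof -
    have "(\<Sum>y\<in>{..<n} \<times> UNIV. h y) = (\<Sum>j<n. \<Sum>b\<in>UNIV. h (j, b))"
      by (subst sum.cartesian_product) simp
    then show ?thesis by (simp add: UNIV_bool add.commute)
  qed
  have total: "(\<Sum>y\<in>{..<n} \<times> UNIV. g r y) = (if r = 1 \<or> r = 2 then 0 else 1)" for r
  proof -
    have "g r (j, True) + g r (j, False) =
        (if r = 1 then 0 else if r = 2 then (if j = i then 1 else 0) - 2 * c else 2 * c)" for j
      by (cases a) (auto simp: g_def)
    then show ?thesis
      using i c by (simp add: sum_bool sum_subtractf mult_ac)
  qed
  show "pretty_good_state_transfer (corona (cocktail_party n) complete_1)
      ((i, a), None) ((i, \<not> a), None)"
  proof (rule pretty_good_state_transfer_corona[where I = "{0, 1, 2}" and f = g and ev = ev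
        and s = s and \<gamma> = "- 1"])
    show "eigenvector (cocktail_party n) (g r) (of_int (ev r))" for r
      unfolding eigenvector_def
    proof
      fix x assume "x \<in> pverts (cocktail_party n)"
      then obtain j b where x: "x = (j, b)" "j < n" by (auto simp: pverts_cocktail_party)
      have "g r (j, True) + g r (j, False) =
          (if r = 1 then 0 else if r = 2 then (if j = i then 1 else 0) - 2 * c else 2 * c)"
        by (cases a) (auto simp: g_def)
      then show "(\<Sum>y\<in>pverts (cocktail_party n). adjacency_matrix (cocktail_party n) x y * g r y)
          = of_int (ev r) * g r x"
        unfolding x(1) sum_neighbours_cocktail_party[OF x(2)] total diff_diff_eq
        using c by (auto simp: ev_def g_def algebra_simps)
    qed
    show "basis_vector (i, a) x = (\<Sum>r\<in>{0, 1, 2}. g r x)" for x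
      by (cases x) (auto simp: g_def basis_vector_def)
    show "basis_vector (i, \<not> a) x = (\<Sum>r\<in>{0, 1, 2}. s r * g r x)" for x
      by (cases x) (auto simp: g_def s_def basis_vector_def)
    show "(\<forall>r\<in>{0, 1, 2}. even (ev r)) \<or> (\<forall>r\<in>{0, 1, 2}. odd (ev r))"
      by (simp add: ev_def)
    show "cis (- (pi / 2) * of_int (ev r)) = - 1 * s r" for r
    proof -
      obtain k where k: "n = 2 * k" using \<open>even n\<close> by blast
      have "- (pi / 2) * of_int (2 * int n - 2) = pi + 2 * pi * of_int (- int k)"
        by (simp add: k algebra_simps)
      then have "cis (- (pi / 2) * of_int (2 * int n - 2)) = - 1"
        by (simp only: cis_mult[symmetric] cis_multiple_2pi[OF Ints_of_int]) simp
      then show ?thesis by (auto simp: ev_def s_def)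
    qed
  qed (auto simp: pverts_cocktail_party)
qed

section \<open>The three families\<close>

theorem corollary5p7:
  shows "(\<forall>d\<ge>2. \<forall>u v. antipodal (hypercube d) u v \<longrightarrow>
            pretty_good_state_transfer (corona (hypercube d) complete_1) (u, None) (v, None))
       \<and> (\<forall>n\<ge>2. even n \<longrightarrow> (\<forall>u v. antipodal (cocktail_party n) u v \<longrightarrow>
            pretty_good_state_transfer (corona (cocktail_party n) complete_1) (u, None) (v, None)))
       \<and> (\<forall>d\<ge>1. \<forall>u v. antipodal (halved_cube (2 * d)) u v \<longrightarrow>
            pretty_good_state_transfer (corona (halved_cube (2 * d)) complete_1) (u, None) (v, None))"
  using hypercube_corona cocktail_party_corona halved_cube_corona by (simp add: split_paired_all)

end
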